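(* Let $q=p^e$ with $p$ an odd prime and $e\ge2$. Let $f\in\mathcal{RF}$ with $\varepsilon\in\{\pm1\}$ the sign of its Walsh transform, and let $$\mathcal{C}_f=\{(af(x)+\mathrm{Tr}_{q/p}(bx)+c)_{x\in\mathbb{F}_q}: a\in\mathbb{F}_p,\ b\in\mathbb{F}_q,\ c\in\mathbb{F}_p\}.$$ Then $\mathcal{C}_f$ is a $[q,e+2]$ linear code over $\mathbb{F}_p$ with the following weight distribution. If $e$ is even: weight $0$ with frequency $1$; weight $p^e-p^{e-1}-\frac{\varepsilon(p-1)\sqrt{p^*}^e}{p}$ with frequency $(p-1)p^e$; weight $p^e-p^{e-1}+\frac{\varepsilon\sqrt{p^*}^e}{p}$ with frequency $(p-1)^2p^e$; weight $p^e-p^{e-1}$ with frequency $p(p^e-1)$; weight $p^e$ with frequency $p-1$. If $e$ is odd: weight $0$ with frequency $1$; weight $p^e-p^{e-1}-\frac{\varepsilon\sqrt{p^*}^eG(\eta_0,\lambda_1)}{p}$ with frequency $\frac{(p-1)^2p^e}{2}$; weight $p^e-p^{e-1}+\frac{\varepsilon\sqrt{p^*}^eG(\eta_0,\lambda_1)}{p}$ with frequency $\frac{(p-1)^2p^e}{2}$; weight $p^e-p^{e-1}$ with frequency $2p^{e+1}-p^e-p$; weight $p^e$ with frequency $p-1$. In particular, $\mathcal{C}_f$ is self-orthogonal for $e\ge3$. Moreover, if $e=2$ and $\varepsilon\eta_0(-1)=-1$, then $\mathcal{C}_f^{\perp}$ is an almost MDS code with parameters $[q,q-4,4]$, optimal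 according to the sphere-packing bound; in all other cases $\mathcal{C}_f^{\perp}$ has parameters $[q,q-e-2,3]$ and is at least almost optimal according to the sphere-packing bound.
   Context: $\zeta_p=e^{2\pi i/p}$; $\mathrm{Tr}_{q/p}$ is the trace map from $\mathbb{F}_q$ to $\mathbb{F}_p$. $p^*=(-1)^{(p-1)/2}p$, and $\sqrt{p^*}$ denotes $\sqrt p$ if $p\equiv1\pmod4$ and $\sqrt{-1}\sqrt p$ if $p\equiv3\pmod4$. $\eta_0$ is the quadratic character of $\mathbb{F}_p$, $\lambda_1(y)=\zeta_p^{y}$ the canonical additive character of $\mathbb{F}_p$, and $G(\eta_0,\lambda_1)=\sum_{y\in\mathbb{F}_p^*}\eta_0(y)\zeta_p^y=\sqrt{-1}^{((p-1)/2)^2}\sqrt p$. For $f:\mathbb{F}_{p^e}\to\mathbb{F}_p$, the Walsh transform is $W_f(\beta)=\sum_{x\in\mathbb{F}_{p^e}}\zeta_p^{f(x)-\mathrm{Tr}_{p^e/p}(\beta x)}$; $f$ is weakly regular bent if there are $\varepsilon\in\{\pm1\}$ (the sign of the Walsh transform) and a function $f^*:\mathbb{F}_{p^e}\to\mathbb{F}_p$ (the dual) with $W_f(\beta)=\varepsilon\sqrt{p^*}^e\zeta_p^{f^*(\beta)}$ for all $\beta$. $\mathcal{RF}$ is the set of weakly regular bent $f$ with $f(0)=0$ and $f(ax)=a^hf(x)$ for all $a\in\mathbb{F}_p^*$, $x\in\mathbb{F}_{p^e}$, for some positive even integer $h$ with $\gcd(h-1,p-1)=1$. An almost MDS code is an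 $[n,k,n-k]$ code. Optimal: no $[n,k,d+1]$ code exists; almost optimal: an optimal $[n,k,d+1]$ code exists; "at least almost optimal according to the sphere-packing bound" means the sphere-packing bound rules out an $[n,k,d+2]$ code, and "optimal according to the sphere-packing bound" that it rules out an $[n,k,d+1]$ code. *)

theory Defs
  imports "HOL-Analysis.Analysis"
begin

text \<open>Setting: the finite field F_q is a finite field type 'a with CARD('a) = p^e.
  The prime field F_p is realised as the prime subfield of 'a, i.e. the image of the integers.\<close>

definition Fp :: "'a::{field,finite} set" where
  "Fp = range (of_int :: int \<Rightarrow> 'a)"

definition tr :: "nat \<Rightarrow> nat \<Rightarrow> 'a::{field,finite} \<Rightarrow> 'a" where
  "tr p e x = (\<Sum>i<e. x ^ (p ^ i))"

text \<open>zeta_p^y for y in F_p (y identified with an integer representative).\<close>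
definition zeta :: "nat \<Rightarrow> 'a::{field,finite} \<Rightarrow> complex" where
  "zeta p y = cis (2 * pi * real_of_int (SOME k. (of_int k :: 'a) = y) / real p)"

definition sqrt_pstar :: "nat \<Rightarrow> complex" where
  "sqrt_pstar p = (if p mod 4 = 1 then complex_of_real (sqrt (real p))
                   else \<i> * complex_of_real (sqrt (real p)))"

definition eta0 :: "'a::{field,finite} \<Rightarrow> complex" where
  "eta0 y = (if y = 0 then 0 else if (\<exists>z\<in>Fp. z ^ 2 = y) then 1 else -1)"

definition gauss_sum :: "nat \<Rightarrow> 'a::{field,finite} itself \<Rightarrow> complex" where
  "gauss_sum p _ = (\<Sum>y\<in>Fp - {0::'a}. eta0 y * zeta p y)"

definition walsh :: "nat \<Rightarrow> nat \<Rightarrow> ('a::{field,finite} \<Rightarrow> 'a) \<Rightarrow> 'a \<Rightarrow> complex" where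
  "walsh p e f \<beta> = (\<Sum>x\<in>UNIV. zeta p (f x - tr p e (\<beta> * x)))"

definition wrb_with_sign :: "nat \<Rightarrow> nat \<Rightarrow> ('a::{field,finite} \<Rightarrow> 'a) \<Rightarrow> int \<Rightarrow> bool" where
  "wrb_with_sign p e f eps \<longleftrightarrow> (\<forall>x. f x \<in> Fp) \<and> eps \<in> {1, -1} \<and>
     (\<exists>fs :: 'a \<Rightarrow> 'a. (\<forall>b. fs b \<in> Fp) \<and>
        (\<forall>b. walsh p e f b = of_int eps * sqrt_pstar p ^ e * zeta p (fs b)))"

definition weakly_regular_bent :: "nat \<Rightarrow> nat \<Rightarrow> ('a::{field,finite} \<Rightarrow> 'a) \<Rightarrow> bool" where
  "weakly_regular_bent p e f \<longleftrightarrow> (\<exists>eps. wrb_with_sign p e f eps)"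

definition in_RF :: "nat \<Rightarrow> nat \<Rightarrow> ('a::{field,finite} \<Rightarrow> 'a) \<Rightarrow> bool" where
  "in_RF p e f \<longleftrightarrow> weakly_regular_bent p e f \<and> f 0 = 0 \<and>
     (\<exists>h::nat. h > 0 \<and> even h \<and> gcd (h - 1) (p - 1) = 1 \<and>
        (\<forall>a\<in>Fp - {0}. \<forall>x. f (a * x) = a ^ h * f x))"

text \<open>Codes over F_p of length q, with coordinates indexed by the elements of F_q.\<close>
definition ambient :: "('a::{field,finite} \<Rightarrow> 'a) set" where
  "ambient = {v. \<forall>x. v x \<in> Fp}"

definition linear_code :: "('a::{field,finite} \<Rightarrow> 'a) set \<Rightarrow> bool" where
  "linear_code C \<longleftrightarrow> C \<subseteq> ambient \<and> (\<lambda>x. 0) \<in> C \<and>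
     (\<forall>u\<in>C. \<forall>v\<in>C. (\<lambda>x. u x + v x) \<in> C) \<and>
     (\<forall>a\<in>Fp. \<forall>v\<in>C. (\<lambda>x. a * v x) \<in> C)"

definition fp_span :: "('a::{field,finite} \<Rightarrow> 'a) set \<Rightarrow> ('a \<Rightarrow> 'a) set" where
  "fp_span B = {(\<lambda>x. \<Sum>v\<in>B. g v * v x) | g. \<forall>v\<in>B. g v \<in> Fp}"

definition fp_indep :: "('a::{field,finite} \<Rightarrow> 'a) set \<Rightarrow> bool" where
  "fp_indep B \<longleftrightarrow> (\<forall>g. (\<forall>v\<in>B. g v \<in> Fp) \<longrightarrow> (\<forall>x. (\<Sum>v\<in>B. g v * v x) = 0) \<longrightarrow> (\<forall>v\<in>B. g v = 0))"

definition code_dim :: "('a::{field,finite} \<Rightarrow> 'a) set \<Rightarrow> nat" where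
  "code_dim C = (THE k. \<exists>B. finite B \<and> B \<subseteq> C \<and> fp_indep B \<and> fp_span B = C \<and> card B = k)"

definition wt :: "('a::{field,finite} \<Rightarrow> 'a) \<Rightarrow> nat" where
  "wt v = card {x. v x \<noteq> 0}"

definition min_dist :: "('a::{field,finite} \<Rightarrow> 'a) set \<Rightarrow> nat" where
  "min_dist C = Min {wt c | c. c \<in> C \<and> c \<noteq> (\<lambda>x. 0)}"

definition dual_code :: "('a::{field,finite} \<Rightarrow> 'a) set \<Rightarrow> ('a \<Rightarrow> 'a) set" where
  "dual_code C = {v \<in> ambient. \<forall>c\<in>C. (\<Sum>x\<in>UNIV. v x * c x) = 0}"

definition self_orthogonal :: "('a::{field,finite} \<Rightarrow> 'a) set \<Rightarrow> bool" where
  "self_orthogonal C \<longleftrightarrow> C \<subseteq> dual_code C"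

definition has_params :: "('a::{field,finite} \<Rightarrow> 'a) set \<Rightarrow> nat \<Rightarrow> nat \<Rightarrow> nat \<Rightarrow> bool" where
  "has_params C n k d \<longleftrightarrow> linear_code C \<and> n = CARD('a) \<and> code_dim C = k \<and> min_dist C = d"

definition almost_MDS :: "('a::{field,finite} \<Rightarrow> 'a) set \<Rightarrow> bool" where
  "almost_MDS C \<longleftrightarrow> linear_code C \<and> min_dist C = CARD('a) - code_dim C"

definition sphere_packing_admits :: "nat \<Rightarrow> nat \<Rightarrow> nat \<Rightarrow> nat \<Rightarrow> bool" where
  "sphere_packing_admits p n k d \<longleftrightarrow>
     p ^ k * (\<Sum>i\<le>(d - 1) div 2. (n choose i) * (p - 1) ^ i) \<le> p ^ n"

definition sp_optimal :: "nat \<Rightarrow> nat \<Rightarrow> nat \<Rightarrow> nat \<Rightarrow> bool" where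
  "sp_optimal p n k d \<longleftrightarrow> \<not> sphere_packing_admits p n k (d + 1)"

definition sp_almost_optimal :: "nat \<Rightarrow> nat \<Rightarrow> nat \<Rightarrow> nat \<Rightarrow> bool" where
  "sp_almost_optimal p n k d \<longleftrightarrow> \<not> sphere_packing_admits p n k (d + 2)"

definition code_Cf :: "nat \<Rightarrow> nat \<Rightarrow> ('a::{field,finite} \<Rightarrow> 'a) \<Rightarrow> ('a \<Rightarrow> 'a) set" where
  "code_Cf p e f = {(\<lambda>x. a * f x + tr p e (b * x) + c) | a b c. a \<in> Fp \<and> c \<in> Fp}"

definition freq :: "('a::{field,finite} \<Rightarrow> 'a) set \<Rightarrow> complex \<Rightarrow> nat" where
  "freq C w = card {c \<in> C. complex_of_nat (wt c) = w}"

end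

theory Submission
  imports Defs "HOL-Computational_Algebra.Polynomial_Factorial"
begin

text \<open>
  The cyclotomic polynomial of prime index is irreducible, so an integer relation between the p-th roots
  of unity has constant coefficients. Expanding the Walsh transform as a sum over the fibres of
  f x - Tr (b x), and its prescribed value as an integer combination of roots of unity (for odd e by
  means of the quadratic Gauss sum, whose square is p*), therefore determines the size of every fibre. The
  sign of the Gauss sum does not matter, since the two weights involving it have equal frequency.

  A codeword a f(x) + Tr (b x) + c with a nonzero vanishes exactly on such a fibre, which gives the weights.
  For e at least 3 all fibre sizes are multiples of p, hence all codewords have square sum zero and the code
  is self-orthogonal. The constant and the trace words force minimum distance at least 3 in
  the dual; a nonzero zero x of f yields a dual word of weight 3 on 0, x and -x. In the exceptional case
  the points (1, x, f x) form an ovoid with its point at infinity removed, so no three of them are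
  collinear and there is no dual word of weight 3, whereas f x = f y yields a word of weight 4 on
  x, -x, y and -y.
\<close>

text \<open>The obstacle is that each Walsh value is a single complex number, while p fibre sizes
  are wanted. Irreducibility comes in Eisenstein fashion: in the field type itself, which has
  characteristic p, the cyclotomic polynomial is (X - 1)^(p - 1), so two nonconstant factors would
  both be divisible by p at 1, although their product there is p. The fibre sizes are then known up
  to a common constant, which their total p^e fixes.

  The factor \<open>zeta p (fs b)\<close> merely translates the coefficient vector. For fixed a and
  b the constant c runs through all translates, so the frequencies depend on p, e and the sign only.

  For e = 2 the words with a nonzero have p + d(p - 1) or p - d zeros, where d is the sign times the
  quadratic character of -1. For d = -1 these are 1 and p + 1, as for plane sections of an elliptic
  paraboloid; for d = 1 they are 2p - 1 and p - 1, as for a hyperbolic one, which contains lines.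
  This is the source of the exceptional case.\<close>

lemma map_poly_of_int_mult:
  "map_poly (of_int :: int \<Rightarrow> 'b::comm_ring_1) (P * Q) = map_poly of_int P * map_poly of_int Q"
  by (intro poly_eqI) (simp add: coeff_map_poly coeff_mult)

lemma map_poly_of_int_add:
  "map_poly (of_int :: int \<Rightarrow> 'b::comm_ring_1) (P + Q) = map_poly of_int P + map_poly of_int Q"
  by (intro poly_eqI) (simp add: coeff_map_poly)

text \<open>Adding 1 permutes the ring, so the sum of all elements is unchanged by one extra 1 per
  element.\<close>

lemma of_nat_CARD_eq_0: "(of_nat CARD('a) :: 'a::{ring_1,finite}) = 0"
proof -
  have "(\<Sum>x\<in>(UNIV::'a set). x + 1) = (\<Sum>x\<in>UNIV. x)"
    by (rule sum.reindex_bij_witness[of _ "\<lambda>x. x - 1" "\<lambda>x. x + 1"]) auto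
  thus ?thesis by (simp add: sum.distrib)
qed

text \<open>Multiplication by a nonzero x permutes the nonzero elements, so their product is
  unchanged by the factor x^(q - 1).\<close>

lemma power_CARD_eq_same: "(x :: 'a::{field,finite}) ^ CARD('a) = x"
proof (cases "x = 0")
  case False
  have "x * (\<Prod>y\<in>UNIV-{0}. x * y) = x * x ^ (CARD('a) - 1) * \<Prod>(UNIV-{0})"
    by (simp add: prod.distrib mult_ac)
  also have "x * x ^ (CARD('a) - 1) = x ^ Suc (CARD('a) - 1)"
    by (subst power_Suc) auto
  also have "Suc (CARD('a) - 1) = CARD('a)"
    using finite_UNIV_card_ge_0[where ?'a = 'a] by simp
  also have "(\<Prod>y\<in>UNIV-{0}. x * y) = (\<Prod>y\<in>UNIV-{0}. y)"
    by (rule prod.reindex_bij_witness[of _ "\<lambda>y. y / x" "\<lambda>y. x * y"]) (use False in auto)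
  finally show ?thesis
    by simp
qed auto

subsection \<open>The prime subfield and the trace\<close>

locale odd_finite_field =
  fixes p e :: nat and ty :: "'a::{field,finite} itself"
  assumes prime_p: "prime p" and odd_p: "odd p" and e_pos: "e \<ge> 1" and card_UNIV: "CARD('a) = p ^ e"
begin

lemma p_ge_3: "p \<ge> 3"
  using prime_p odd_p by (metis One_nat_def Suc_leI dvd_refl eval_nat_numeral(3) le_neq_implies_less prime_ge_2_nat)

lemma CHAR_eq: "CHAR('a) = p"
proof -
  have "CHAR('a) dvd p ^ e"
    using of_nat_CARD_eq_0[where 'a='a] card_UNIV by (simp only: of_nat_eq_0_iff_char_dvd)
  moreover have "prime CHAR('a)"
    using prime_CHAR_semidom finite_imp_CHAR_pos by (metis finite)
  ultimately show ?thesis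
    using prime_p primes_dvd_imp_eq prime_dvd_power by blast
qed

lemma of_int_Fp_eq_iff: "(of_int k :: 'a) = of_int l \<longleftrightarrow> int p dvd k - l"
  using of_int_eq_0_iff_char_dvd[of "k - l", where 'a='a] by (simp add: CHAR_eq)

lemma two_neq_0 [simp]: "(2 :: 'a) \<noteq> 0"
proof
  assume "(2 :: 'a) = 0"
  hence "(of_int 2 :: 'a) = of_int 0" by simp
  hence "int p dvd 2" by (subst (asm) of_int_Fp_eq_iff) simp
  thus False using p_ge_3 zdvd_imp_le[of "int p" 2] by simp
qed

lemma Fp_of_int [simp, intro]: "of_int k \<in> (Fp :: 'a set)"
  and Fp_0 [simp, intro]: "0 \<in> (Fp :: 'a set)"
  and Fp_1 [simp, intro]: "1 \<in> (Fp :: 'a set)"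
proof -
  show *: "of_int k \<in> (Fp :: 'a set)" for k by (auto simp: Fp_def)
  show "0 \<in> (Fp :: 'a set)" "1 \<in> (Fp :: 'a set)" using *[of 0] *[of 1] by auto
qed

lemma Fp_add [intro]: "x \<in> Fp \<Longrightarrow> y \<in> Fp \<Longrightarrow> x + y \<in> (Fp :: 'a set)"
  and Fp_mult [intro]: "x \<in> Fp \<Longrightarrow> y \<in> Fp \<Longrightarrow> x * y \<in> (Fp :: 'a set)"
  and Fp_diff [intro]: "x \<in> Fp \<Longrightarrow> y \<in> Fp \<Longrightarrow> x - y \<in> (Fp :: 'a set)"
  by (auto simp: Fp_def simp flip: of_int_add of_int_mult of_int_diff)

lemma Fp_uminus [simp]: "- x \<in> Fp \<longleftrightarrow> x \<in> (Fp :: 'a set)"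
  using Fp_diff[of 0 x] Fp_diff[of 0 "-x"] by auto

lemma Fp_sum [intro]: "(\<And>i. i \<in> A \<Longrightarrow> g i \<in> Fp) \<Longrightarrow> sum g A \<in> (Fp :: 'a set)"
  by (induction A rule: infinite_finite_induct) auto

lemma Fp_power [intro]: "x \<in> Fp \<Longrightarrow> x ^ n \<in> (Fp :: 'a set)"
  by (induction n) auto

lemma bij_betw_of_nat_Fp: "bij_betw (of_nat :: nat \<Rightarrow> 'a) {..<p} Fp"
proof (rule bij_betw_imageI)
  show "inj_on (of_nat :: nat \<Rightarrow> 'a) {..<p}"
  proof (rule inj_onI)
    fix i j assume ij: "i \<in> {..<p}" "j \<in> {..<p}" "(of_nat i :: 'a) = of_nat j"
    hence "(of_int (int i) :: 'a) = of_int (int j)" by simp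
    hence "int p dvd int i - int j" by (simp only: of_int_Fp_eq_iff)
    hence "int i mod int p = int j mod int p" by (simp add: mod_eq_dvd_iff)
    thus "i = j" using ij by simp
  qed
  show "(of_nat :: nat \<Rightarrow> 'a) ` {..<p} = Fp"
  proof (intro equalityI subsetI)
    fix y :: 'a assume "y \<in> Fp"
    then obtain k where k: "y = of_int k" by (auto simp: Fp_def)
    have "(of_int k :: 'a) = of_int (k mod int p)"
      by (simp only: of_int_Fp_eq_iff) (simp add: dvd_minus_mod)
    moreover have "k mod int p \<ge> 0" "k mod int p < int p"
      using p_ge_3 by auto
    ultimately have "y = of_nat (nat (k mod int p))" "nat (k mod int p) \<in> {..<p}"
      using k by auto
    thus "y \<in> of_nat ` {..<p}" by blast
  next
    fix y :: 'a assume "y \<in> of_nat ` {..<p}"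
    then obtain i where "y = of_nat i" by blast
    thus "y \<in> Fp" using Fp_of_int[of "int i"] by simp
  qed
qed

lemma card_Fp: "card (Fp :: 'a set) = p"
  using bij_betw_same_card[OF bij_betw_of_nat_Fp] by simp

lemma add_power_p: "(x + y :: 'a) ^ p ^ i = x ^ p ^ i + y ^ p ^ i"
  by (rule freshmans_dream') (simp_all add: CHAR_eq prime_p)

lemma Fp_power_p: "x \<in> Fp \<Longrightarrow> x ^ p = (x :: 'a)"
proof -
  have *: "(of_nat n :: 'a) ^ p = of_nat n" for n
    using add_power_p[of 1 _ 1] p_ge_3 by (induction n) simp_all
  assume "x \<in> Fp"
  then obtain n where "x = of_nat n" using bij_betw_of_nat_Fp by (auto simp: bij_betw_def)
  thus ?thesis using * by simp
qed

lemma Fp_power_p_power: "x \<in> Fp \<Longrightarrow> x ^ p ^ i = (x :: 'a)"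
  by (induction i) (simp_all add: power_mult Fp_power_p mult.commute)

text \<open>X^p - X has at most p roots, and the prime field already supplies p of them. Membership
  thus becomes an equation that can be checked for inverses and traces.\<close>

lemma Fp_eq_roots: "Fp = {x::'a. x ^ p = x}"
proof -
  define P :: "'a poly" where "P = monom 1 p - monom 1 1"
  have "coeff P p = 1" using p_ge_3 by (simp add: P_def)
  moreover have "degree P \<le> p" unfolding P_def
    using p_ge_3 by (intro degree_diff_le) (auto simp: degree_monom_eq)
  ultimately have "card {x::'a. poly P x = 0} \<le> p"
    using card_poly_roots_bound[of P] by (metis coeff_0 le_trans zero_neq_one)
  moreover have "poly P x = 0 \<longleftrightarrow> x ^ p = x" for x
    by (simp add: P_def poly_monom)
  ultimately have "card {x::'a. x ^ p = x} \<le> card (Fp :: 'a set)"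
    using card_Fp by simp
  thus ?thesis
    using Fp_power_p by (intro card_seteq) auto
qed

lemma Fp_inverse [intro]: "x \<in> Fp \<Longrightarrow> inverse x \<in> (Fp :: 'a set)"
  by (simp add: Fp_eq_roots power_inverse)

lemma Fp_divide [intro]: "x \<in> Fp \<Longrightarrow> y \<in> Fp \<Longrightarrow> x / y \<in> (Fp :: 'a set)"
  by (simp add: divide_inverse Fp_inverse Fp_mult)

abbreviation Tr :: "'a \<Rightarrow> 'a" where "Tr \<equiv> tr p e"

lemma tr_add: "Tr (x + y) = Tr x + Tr y"
  by (simp add: tr_def add_power_p sum.distrib)

lemma tr_0 [simp]: "Tr 0 = 0"
  using tr_add[of 0 0] by (metis add_0 add_cancel_right_left)

lemma tr_uminus: "Tr (- x) = - Tr x"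
  using tr_add[of x "-x"] by (simp add: add_eq_0_iff)

lemma tr_diff: "Tr (x - y) = Tr x - Tr y"
  using tr_add[of x "-y"] by (simp add: tr_uminus)

lemma tr_scale: "a \<in> Fp \<Longrightarrow> Tr (a * x) = a * Tr x"
  by (simp add: tr_def power_mult_distrib Fp_power_p_power sum_distrib_left)

text \<open>Frobenius permutes the e conjugates of x cyclically because x^(p^e) = x, so it fixes
  their sum.\<close>

lemma tr_in_Fp [simp, intro]: "Tr x \<in> Fp"
proof -
  have "(Tr x) ^ p = (\<Sum>i<e. (x ^ p ^ i) ^ p)"
    unfolding tr_def by (rule freshmans_dream_sum) (simp_all add: CHAR_eq prime_p)
  also have "\<dots> = (\<Sum>i<e. x ^ p ^ Suc i)"
    by (simp add: mult.commute flip: power_mult)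
  also have "\<dots> = (\<Sum>i<Suc e. x ^ p ^ i) - x"
    by (subst sum.lessThan_Suc_shift) simp
  also have "\<dots> = Tr x"
    using power_CARD_eq_same[of x] by (simp add: tr_def card_UNIV)
  finally show ?thesis by (simp add: Fp_eq_roots)
qed

text \<open>The trace is given by a nonzero polynomial of degree at most p^(e - 1), too small to
  vanish on all p^e elements.\<close>

lemma ex_tr_neq_0: "\<exists>x. Tr x \<noteq> 0"
proof (rule ccontr)
  assume "\<not> ?thesis"
  hence *: "{x. Tr x = 0} = UNIV" by auto
  define P :: "'a poly" where "P = (\<Sum>i<e. monom 1 (p ^ i))"
  have poly_P: "poly P x = Tr x" for x
    by (simp add: P_def tr_def poly_sum poly_monom)
  have "coeff P (p ^ (e - 1)) = (\<Sum>i<e. if i = e - 1 then 1 else 0)"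
    unfolding P_def coeff_sum using p_ge_3 by (intro sum.cong) (auto dest: power_inject_exp[THEN iffD1, rotated])
  hence "coeff P (p ^ (e - 1)) = 1" using e_pos by simp
  hence "P \<noteq> 0" by auto
  moreover have "degree P \<le> p ^ (e - 1)" unfolding P_def
    using p_ge_3 by (intro degree_sum_le) (auto simp: degree_monom_eq intro!: power_increasing)
  ultimately have "card {x. poly P x = 0} \<le> p ^ (e - 1)"
    using card_poly_roots_bound le_trans by blast
  hence "p ^ e \<le> p ^ (e - 1)" using * by (simp add: poly_P card_UNIV)
  thus False using p_ge_3 e_pos by (simp add: power_le_imp_le_exp)
qed

lemma tr_surj_mult:
  assumes "u \<noteq> 0" "c \<in> Fp"
  obtains b where "Tr (b * u) = c"
proof -
  obtain x where x: "Tr x \<noteq> 0" using ex_tr_neq_0 by blast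
  have "Tr ((c / Tr x * (x / u)) * u) = Tr (c / Tr x * x)" using assms by simp
  also have "\<dots> = c" using x assms by (subst tr_scale) auto
  finally show ?thesis using that by blast
qed

subsection \<open>The additive character and integer relations between roots of unity\<close>

text \<open>The \<open>SOME\<close> in \<open>zeta\<close> picks an unspecified representative; two
  of them differ by a multiple of p, which adds full turns to the angle.\<close>

lemma zeta_of_int: "zeta p (of_int k :: 'a) = cis (2 * pi * real_of_int k / real p)"
proof -
  define l where "l = (SOME l. (of_int l :: 'a) = of_int k)"
  have "(of_int l :: 'a) = of_int k" unfolding l_def by (rule someI[of _ k]) simp
  hence "int p dvd l - k" by (simp only: of_int_Fp_eq_iff)
  then obtain m where "l - k = int p * m" by (elim dvdE)
  hence l: "l = k + int p * m" by simp
  have "2 * pi * real_of_int l / real p = 2 * pi * real_of_int k / real p + 2 * pi * of_int m"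
    using p_ge_3 by (simp add: l field_simps)
  hence "cis (2 * pi * real_of_int l / real p) = cis (2 * pi * real_of_int k / real p) * cis (2 * pi * of_int m)"
    by (simp only: cis_mult)
  thus ?thesis by (simp add: zeta_def l_def)
qed

lemma zeta_0 [simp]: "zeta p (0 :: 'a) = 1"
  using zeta_of_int[of 0] by simp

lemma zeta_add: "x \<in> Fp \<Longrightarrow> y \<in> Fp \<Longrightarrow> zeta p (x + y :: 'a) = zeta p x * zeta p y"
  by (auto simp: Fp_def zeta_of_int cis_mult simp flip: of_int_add) (simp add: add_divide_distrib distrib_left)

lemma zeta_uminus: "x \<in> Fp \<Longrightarrow> zeta p (- x :: 'a) = cnj (zeta p x)"
  by (auto simp: Fp_def zeta_of_int cis_cnj simp flip: of_int_minus) simp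

lemma zeta_of_nat: "zeta p (of_nat k :: 'a) = cis (2 * pi / real p) ^ k"
  using zeta_of_int[of "int k"] by (simp add: Complex.DeMoivre mult_ac)

lemma sum_Fp_conv_lessThan: "(\<Sum>j\<in>(Fp :: 'a set). g j) = (\<Sum>k<p. g (of_nat k))"
  using sum.reindex_bij_betw[OF bij_betw_of_nat_Fp, of g] by simp

lemma bij_betw_zeta: "bij_betw (zeta p) (Fp :: 'a set) {z. z ^ p = 1}"
proof -
  have "bij_betw (\<lambda>k. cis (2 * pi * real k / real p)) {..<p} {z. z ^ p = 1}"
    using Complex.bij_betw_roots_unity[of p] p_ge_3 by simp
  also have "(\<lambda>k. cis (2 * pi * real k / real p)) = zeta p \<circ> (of_nat :: nat \<Rightarrow> 'a)"
    using zeta_of_int[of "int _"] by auto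
  finally show ?thesis
    using bij_betw_comp_iff[OF bij_betw_of_nat_Fp] by blast
qed

lemma zeta_eq_1_iff: "x \<in> Fp \<Longrightarrow> zeta p (x :: 'a) = 1 \<longleftrightarrow> x = 0"
  using bij_betw_zeta zeta_0 Fp_0 unfolding bij_betw_def inj_on_def by metis

lemma sum_zeta: "(\<Sum>y\<in>(Fp :: 'a set). zeta p y) = 0"
  using sum.reindex_bij_betw[OF bij_betw_zeta, of "\<lambda>z. z"] sum_roots_unity[of p] p_ge_3 by simp

lemma sum_zeta_mult:
  assumes "a \<in> Fp"
  shows "(\<Sum>y\<in>(Fp :: 'a set). zeta p (a * y)) = (if a = 0 then of_nat p else 0)"
proof (cases "a = 0")
  case False
  have "(\<Sum>y\<in>(Fp :: 'a set). zeta p (a * y)) = (\<Sum>y\<in>(Fp :: 'a set). zeta p y)"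
    using assms False by (intro sum.reindex_bij_witness[of _ "\<lambda>y. y / a" "\<lambda>y. a * y"]) auto
  thus ?thesis using False by (simp add: sum_zeta)
qed (simp add: card_Fp)

section \<open>Irreducibility of the cyclotomic polynomial of prime index\<close>

text \<open>Multiplied by X - 1, both sides become X^p - 1: the p-th power is additive in
  characteristic p, and (-1)^p = -1 since p is odd.\<close>

lemma cyclotomic_poly_mod_p:
  "(\<Sum>i<p. monom 1 i :: 'a poly) = [:-1, 1:] ^ (p - 1)"
proof -
  have "[:-1, 1:] * (\<Sum>i<p. monom 1 i :: 'a poly) = [:0, 1:] ^ p - 1"
    by (simp add: power_diff_1_eq monom_altdef) (simp add: one_pCons)
  also have "\<dots> = [:-1, 1:] ^ p"
  proof -
    have "([:-1:] + [:0, 1 :: 'a:]) ^ p = [:-1:] ^ p + [:0, 1:] ^ p"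
      by (rule freshmans_dream) (simp_all add: CHAR_eq prime_p)
    moreover have "[:-1 :: 'a:] ^ p = [:-1:]" using odd_p by (simp add: poly_const_pow)
    ultimately show ?thesis by (simp add: one_pCons)
  qed
  also have "\<dots> = [:-1, 1:] * [:-1, 1:] ^ (p - 1)"
    using p_ge_3 by (cases p) auto
  finally show ?thesis by (metis mult_cancel_left pCons_eq_0_iff zero_neq_one)
qed

lemma degree_cyclotomic_poly: "degree (\<Sum>i<p. monom 1 i :: int poly) = p - 1"
  and lead_coeff_cyclotomic_poly: "lead_coeff (\<Sum>i<p. monom 1 i :: int poly) = 1"
proof -
  have c: "coeff (\<Sum>i<p. monom 1 i :: int poly) k = (if k < p then 1 else 0)" for k
    by (simp add: coeff_sum)
  show d: "degree (\<Sum>i<p. monom 1 i :: int poly) = p - 1"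
  proof (rule antisym)
    show "degree (\<Sum>i<p. monom 1 i :: int poly) \<le> p - 1"
      by (rule degree_le) (auto simp: c)
    show "p - 1 \<le> degree (\<Sum>i<p. monom 1 i :: int poly)"
      by (rule le_degree) (use p_ge_3 in \<open>auto simp: c\<close>)
  qed
  show "lead_coeff (\<Sum>i<p. monom 1 i :: int poly) = 1"
    using p_ge_3 by (simp add: c d)
qed

text \<open>Modulo p the cyclotomic polynomial is a power of X - 1, so each nonconstant factor vanishes at 1
  modulo p.\<close>
lemma dvd_poly_1_of_cyclotomic_factor:
  fixes P Q :: "int poly"
  assumes PQ: "(\<Sum>i<p. monom 1 i) = P * Q" and P: "degree P > 0"
  shows "int p dvd poly P 1"
proof -
  let ?h = "map_poly (of_int :: int \<Rightarrow> 'a)"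
  \<comment> \<open>The leading coefficients are units, so reduction modulo p preserves both
    degrees. The orders at 1 then add up to the full degree p - 1, which forces each order to equal
    the degree of its factor.\<close>
  have lc: "lead_coeff P * lead_coeff Q = 1"
    using lead_coeff_cyclotomic_poly PQ by (simp add: lead_coeff_mult)
  hence "\<bar>lead_coeff P\<bar> = 1" "\<bar>lead_coeff Q\<bar> = 1"
    using zmult_eq_1_iff by fastforce+
  hence "of_int (lead_coeff P) \<noteq> (0 :: 'a)" "of_int (lead_coeff Q) \<noteq> (0 :: 'a)"
    by (auto simp: abs_if split: if_splits)
  hence deg: "degree (?h P) = degree P" "degree (?h Q) = degree Q"
    by (intro map_poly_degree_eq; simp)+
  have "?h P * ?h Q = ?h (\<Sum>i<p. monom 1 i)"
    by (simp add: PQ map_poly_of_int_mult)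
  also have "\<dots> = (\<Sum>i<p. monom 1 i)"
    by (intro poly_eqI) (simp add: coeff_map_poly coeff_sum)
  finally have eq: "?h P * ?h Q = [:-1, 1:] ^ (p - 1)"
    by (simp add: cyclotomic_poly_mod_p)
  hence nz: "?h P * ?h Q \<noteq> 0" by simp
  hence nz0: "?h P \<noteq> 0" "?h Q \<noteq> 0" by (metis mult_zero_left, metis mult_zero_right)
  have "order 1 (?h P) + order 1 (?h Q) = p - 1"
    using order_mult[OF nz, of 1] order_power_n_n[of "1 :: 'a" "p - 1"] eq by simp
  moreover have "degree (?h P) + degree (?h Q) = p - 1"
    using degree_mult_eq[OF nz0] eq by (simp add: degree_power_eq)
  moreover have "order 1 (?h P) \<le> degree (?h P)" "order 1 (?h Q) \<le> degree (?h Q)"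
    by (intro order_degree nz0)+
  ultimately have "order 1 (?h P) > 0" using P deg by linarith
  hence "poly (?h P) 1 = 0" using order_root[of "?h P" 1] by blast
  moreover have "poly (?h P) 1 = of_int (poly P 1)"
    by (induction P) (simp_all add: map_poly_pCons)
  ultimately show ?thesis using of_int_Fp_eq_iff[of "poly P 1" 0] by simp
qed

text \<open>An integer polynomial of least degree vanishing at the root of unity has a primitive
  part T that divides the cyclotomic polynomial. A nonconstant cofactor would make p * p divide the
  value p at 1, so T has degree p - 1.\<close>

lemma degree_ge_if_root_zeta:
  fixes P :: "int poly"
  assumes "P \<noteq> 0" and "poly (map_poly of_int P) (cis (2 * pi / real p)) = 0"
  shows "degree P \<ge> p - 1"
proof -
  let ?w = "cis (2 * pi / real p)"
  define ev where "ev = (\<lambda>P :: int poly. poly (map_poly of_int P) ?w)"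
  have ev_mult: "ev (A * B) = ev A * ev B" and ev_add: "ev (A + B) = ev A + ev B" for A B
    by (simp_all add: ev_def map_poly_of_int_mult map_poly_of_int_add)
  have ev_const: "ev [:c:] = of_int c" for c
    by (simp add: ev_def map_poly_pCons)
  define Phi :: "int poly" where "Phi = (\<Sum>i<p. monom 1 i)"
  have "map_poly of_int Phi = (\<Sum>i<p. monom 1 i :: complex poly)"
    by (intro poly_eqI) (simp add: coeff_map_poly coeff_sum Phi_def)
  hence "ev Phi = (\<Sum>i<p. ?w ^ i)"
    by (simp add: ev_def poly_sum poly_monom)
  also have "\<dots> = 0"
    using sum_zeta by (simp add: sum_Fp_conv_lessThan zeta_of_nat)
  finally have ev_Phi: "ev Phi = 0" .
  obtain R where R: "R \<noteq> 0" "ev R = 0" and R_min: "\<And>S. S \<noteq> 0 \<Longrightarrow> ev S = 0 \<Longrightarrow> degree R \<le> degree S"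
    using ex_has_least_nat[of "\<lambda>S. S \<noteq> 0 \<and> ev S = 0" P degree] assms by (auto simp: ev_def)
  define T where "T = primitive_part R"
  have R_eq: "R = [:content R:] * T"
    by (simp add: T_def)
  have T: "T \<noteq> 0" "ev T = 0" "content T = 1" "degree T = degree R"
  proof -
    show "T \<noteq> 0" "content T = 1" "degree T = degree R"
      using R by (simp_all add: T_def)
    have "ev R = of_int (content R) * ev T" by (subst R_eq) (simp only: ev_mult ev_const)
    thus "ev T = 0" using R by simp
  qed
  \<comment> \<open>Pseudo-division stays within integer polynomials at the price of a scalar
    \<open>c\<close> in front of \<open>Phi\<close>. The remainder vanishes at the root of unity, so
    minimality makes it zero.\<close>
  obtain A B where AB: "pseudo_divmod Phi T = (A, B)" by fastforce
  have pd: "smult (coeff T (degree T) ^ (Suc (degree Phi) - degree T)) Phi = T * A + B"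
      "B = 0 \<or> degree B < degree T"
    using pseudo_divmod[OF T(1) AB] by auto
  define c where "c = coeff T (degree T) ^ (Suc (degree Phi) - degree T)"
  have "[:c:] * Phi = T * A + B" using pd by (simp add: c_def)
  hence "ev ([:c:] * Phi) = ev (T * A + B)" by simp
  hence "ev B = 0" by (simp only: ev_mult ev_add ev_Phi T) simp
  hence "B = 0" using pd(2) R_min[of B] T(4) by force
  hence "T dvd smult c Phi" using pd by (simp add: c_def)
  \<comment> \<open>Over the rationals the scalar is a unit and disappears; Gauss's lemma brings the
    divisibility back because \<open>T\<close> is primitive.\<close>
  hence "fract_poly T dvd fract_poly (smult c Phi)" by (rule fract_poly_dvd)
  moreover have "c \<noteq> 0" using T(1) by (simp add: c_def)
  ultimately have "fract_poly T dvd fract_poly Phi"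
    by (simp add: fract_poly_smult dvd_smult_iff)
  hence "T dvd Phi" using T(3) by (rule fract_poly_dvdD)
  then obtain Q where Q: "Phi = T * Q" by (elim dvdE)
  have "degree T > 0"
  proof (rule ccontr)
    assume "\<not> degree T > 0"
    then obtain t where "T = [:t:]" using degree_eq_zeroE by blast
    thus False using T ev_const[of t] by simp
  qed
  have deg_sum: "degree Phi = degree T + degree Q"
  proof -
    have "Phi \<noteq> 0" using lead_coeff_cyclotomic_poly by (auto simp: Phi_def)
    thus ?thesis using Q by (auto simp: degree_mult_eq)
  qed
  have "degree Q = 0"
  proof (rule ccontr)
    assume "degree Q \<noteq> 0"
    hence "int p dvd poly Q 1"
      using dvd_poly_1_of_cyclotomic_factor[of Q T] Q by (simp add: Phi_def mult.commute)
    moreover have "int p dvd poly T 1"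
      using dvd_poly_1_of_cyclotomic_factor[of T Q] Q \<open>degree T > 0\<close> by (simp add: Phi_def)
    ultimately have "int p * int p dvd poly Phi 1" by (simp add: Q mult_dvd_mono)
    moreover have "poly Phi 1 = int p" by (simp add: Phi_def poly_sum poly_monom)
    ultimately have "int p * int p dvd int p * 1" by simp
    hence "int p dvd 1" using p_ge_3 by (subst (asm) dvd_mult_cancel_left) auto
    thus False using p_ge_3 by simp
  qed
  hence "degree T = p - 1" using deg_sum degree_cyclotomic_poly by (simp add: Phi_def)
  thus ?thesis using R_min[of P] assms T(4) by (simp add: ev_def)
qed

text \<open>Subtracting a multiple of 1 + w + ... + w^(p - 1) = 0 removes the coefficient of w^(p -
  1). What is left has degree below p - 1, so it is the zero polynomial.\<close>

lemma zeta_int_relation_const: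
  fixes N :: "'a \<Rightarrow> int"
  assumes "(\<Sum>j\<in>Fp. of_int (N j) * zeta p j) = 0" and "i \<in> Fp" "j \<in> Fp"
  shows "N i = N j"
proof -
  let ?w = "cis (2 * pi / real p)"
  define m where "m = N (of_nat (p - 1))"
  define P :: "int poly" where "P = (\<Sum>k<p. monom (N (of_nat k) - m) k)"
  have cP: "coeff P k = (if k < p then N (of_nat k) - m else 0)" for k
    by (simp add: P_def coeff_sum)
  have "map_poly of_int P = (\<Sum>k<p. monom (of_int (N (of_nat k) - m)) k :: complex poly)"
    by (intro poly_eqI) (simp add: coeff_map_poly coeff_sum cP)
  hence "poly (map_poly of_int P) ?w = (\<Sum>k<p. of_int (N (of_nat k) - m) * ?w ^ k)"
    by (simp add: poly_sum poly_monom)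
  also have "\<dots> = (\<Sum>j\<in>Fp. of_int (N j - m) * zeta p j)"
    by (simp add: sum_Fp_conv_lessThan zeta_of_nat)
  also have "\<dots> = (\<Sum>j\<in>Fp. of_int (N j) * zeta p j) - of_int m * (\<Sum>j\<in>(Fp::'a set). zeta p j)"
    by (simp add: sum_distrib_left sum_subtractf left_diff_distrib)
  finally have root: "poly (map_poly of_int P) ?w = 0"
    using assms by (simp add: sum_zeta)
  have "degree P < p - 1"
  proof -
    have "degree P \<le> p - 2"
    proof (rule degree_le, intro allI impI)
      fix k assume "k > p - 2"
      hence "k = p - 1 \<or> k \<ge> p" by auto
      thus "coeff P k = 0" by (auto simp: cP m_def)
    qed
    thus ?thesis using p_ge_3 by simp
  qed
  hence P0: "P = 0" using degree_ge_if_root_zeta[of P] root by fastforce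
  have "N i = m" if "i \<in> Fp" for i
  proof -
    have "i \<in> of_nat ` {..<p}" using that bij_betw_imp_surj_on[OF bij_betw_of_nat_Fp] by simp
    then obtain k where "k < p" "i = of_nat k" by (elim imageE) simp
    thus ?thesis using cP[of k] P0 by simp
  qed
  thus ?thesis using assms by simp
qed

end

subsection \<open>The quadratic Gauss sum\<close>

text \<open>An integer-valued version of \<open>eta0\<close>, so that its values can serve as
  coefficients in integer relations between roots of unity and in formulas for
  cardinalities.\<close>

definition quad_char :: "'a::{field,finite} \<Rightarrow> int" where
  "quad_char y = (if y = 0 then 0 else if (\<exists>z\<in>Fp. z ^ 2 = y) then 1 else -1)"

lemma eta0_eq_quad_char: "eta0 y = of_int (quad_char y)"
  by (simp add: eta0_def quad_char_def)

lemma quad_char_0 [simp]: "quad_char 0 = 0"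
  by (simp add: quad_char_def)

lemma quad_char_cases: "quad_char y = 1 \<or> quad_char y = -1 \<or> quad_char y = 0"
  by (simp add: quad_char_def)

lemma quad_char_eq_0_iff [simp]: "quad_char y = 0 \<longleftrightarrow> y = 0"
  by (simp add: quad_char_def)

context odd_finite_field
begin

lemma neq_uminus: "x \<noteq> 0 \<Longrightarrow> x \<noteq> - (x :: 'a)"
proof
  assume "x \<noteq> 0" "x = - x"
  hence "2 * x = 0" by (metis add.right_inverse mult_2)
  thus False using \<open>x \<noteq> 0\<close> by simp
qed

lemma card_square_roots: "y \<in> Fp \<Longrightarrow> int (card {z\<in>Fp. z ^ 2 = (y :: 'a)}) = 1 + quad_char y"
proof -
  assume "y \<in> Fp"
  consider "y = 0" | w where "y \<noteq> 0" "w \<in> Fp" "w ^ 2 = y" | "y \<noteq> 0" "\<not> (\<exists>z\<in>Fp. z ^ 2 = y)" by blast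
  thus ?thesis
  proof cases
    case 1
    hence "{z\<in>Fp. z ^ 2 = y} = {0}" by auto
    thus ?thesis using 1 by simp
  next
    case 2
    have "{z\<in>Fp. z ^ 2 = y} = {w, - w}"
      using 2 by (auto simp: power2_eq_iff)
    moreover have "w \<noteq> - w" using 2 neq_uminus[of w] by auto
    moreover have "quad_char y = 1" using 2 by (auto simp: quad_char_def)
    ultimately show ?thesis by simp
  next
    case 3
    hence "{z\<in>Fp. z ^ 2 = y} = {}" by auto
    hence "card {z\<in>Fp. z ^ 2 = y} = 0" by (simp only: card.empty)
    moreover have "quad_char y = -1" using 3 by (auto simp: quad_char_def)
    ultimately show ?thesis by simp
  qed
qed

lemma sum_squares: "(\<Sum>z\<in>Fp. g (z ^ 2)) = (\<Sum>y\<in>Fp. (1 + of_int (quad_char (y :: 'a))) * (g y :: complex))"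
proof -
  have "(\<Sum>z\<in>(Fp :: 'a set). g (z ^ 2)) = (\<Sum>y\<in>Fp. \<Sum>z\<in>{z. z \<in> Fp \<and> z ^ 2 = y}. g (z ^ 2))"
    by (rule sum.group[symmetric]) (auto intro: Fp_power)
  also have "\<dots> = (\<Sum>y\<in>Fp. of_int (int (card {z\<in>Fp. z ^ 2 = y})) * g y)"
    by (intro sum.cong refl) simp
  also have "\<dots> = (\<Sum>y\<in>Fp. (1 + of_int (quad_char (y :: 'a))) * (g y :: complex))"
    by (intro sum.cong refl, subst card_square_roots) simp_all
  finally show ?thesis .
qed

lemma sum_quad_char: "(\<Sum>y\<in>Fp. quad_char (y :: 'a)) = 0"
proof -
  have "(of_nat p :: complex) = of_nat p + (\<Sum>y\<in>Fp. of_int (quad_char (y :: 'a)))"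
    using sum_squares[of "\<lambda>_. 1"] by (simp add: card_Fp sum.distrib)
  hence "(of_int (\<Sum>y\<in>Fp. quad_char (y :: 'a)) :: complex) = 0" by simp
  thus ?thesis by (simp only: of_int_eq_0_iff)
qed

lemma card_quad_char:
  assumes "\<sigma> = 1 \<or> \<sigma> = -1"
  shows "2 * card {y\<in>Fp. quad_char (y :: 'a) = \<sigma>} = p - 1"
proof -
  define A B where "A = {y\<in>Fp. quad_char (y :: 'a) = 1}" and "B = {y\<in>Fp. quad_char (y :: 'a) = -1}"
  have Fp: "Fp = insert (0 :: 'a) (A \<union> B)"
    using quad_char_cases by (auto simp: A_def B_def)
  have nin: "(0 :: 'a) \<notin> A \<union> B" "A \<inter> B = {}" by (auto simp: A_def B_def)
  have "card A + card B = p - 1"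
    using card_Fp nin by (subst (asm) Fp) (simp add: card_Un_disjoint)
  moreover have "(\<Sum>y\<in>Fp. quad_char (y :: 'a)) = (\<Sum>y\<in>A. quad_char y) + (\<Sum>y\<in>B. quad_char y)"
    using nin by (subst Fp) (simp add: sum.union_disjoint)
  moreover have "(\<Sum>y\<in>A. quad_char y) = int (card A)" "(\<Sum>y\<in>B. quad_char y) = - int (card B)"
    by (simp_all add: A_def B_def)
  ultimately show ?thesis using assms sum_quad_char by (auto simp: A_def B_def)
qed

abbreviation G :: complex where "G \<equiv> gauss_sum p ty"

lemma gauss_sum_eq: "G = (\<Sum>y\<in>Fp. of_int (quad_char (y :: 'a)) * zeta p y)"
  unfolding gauss_sum_def eta0_eq_quad_char by (rule sum.mono_neutral_left) auto

lemma gauss_sum_eq_squares: "G = (\<Sum>z\<in>(Fp :: 'a set). zeta p (z ^ 2))"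
  by (simp add: sum_squares gauss_sum_eq distrib_right sum.distrib sum_zeta)

text \<open>Writing x = y + d turns x^2 - y^2 into d^2 + 2dy, which is linear in y. The sum over y
  therefore vanishes unless d = 0.\<close>

lemma gauss_sum_mult_cnj: "G * cnj G = of_nat p"
proof -
  have "G * cnj G = (\<Sum>y\<in>(Fp :: 'a set). \<Sum>x\<in>(Fp :: 'a set). zeta p (x ^ 2) * zeta p (- (y ^ 2)))"
    by (simp add: gauss_sum_eq_squares sum_product sum_distrib_left sum_distrib_right zeta_uminus Fp_power)
  also have "\<dots> = (\<Sum>y\<in>(Fp :: 'a set). \<Sum>d\<in>(Fp :: 'a set). zeta p ((y + d) ^ 2) * zeta p (- (y ^ 2)))"
    by (intro sum.cong refl sum.reindex_bij_witness[of _ "\<lambda>d. _ + d" "\<lambda>x. x - _"]) auto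
  also have "\<dots> = (\<Sum>y\<in>(Fp :: 'a set). \<Sum>d\<in>(Fp :: 'a set). zeta p (d ^ 2) * zeta p ((2 * d) * y))"
  proof (intro sum.cong refl)
    fix y d :: 'a assume yd: "y \<in> Fp" "d \<in> Fp"
    have two: "2 \<in> (Fp :: 'a set)" using Fp_of_int[of 2] by simp
    have "zeta p ((y + d) ^ 2) * zeta p (- (y ^ 2)) = zeta p ((y + d) ^ 2 + - (y ^ 2))"
      using yd by (intro zeta_add[symmetric]) (auto intro!: Fp_power)
    also have "(y + d) ^ 2 + - (y ^ 2) = d ^ 2 + (2 * d) * y"
      by (simp add: power2_eq_square algebra_simps)
    also have "zeta p \<dots> = zeta p (d ^ 2) * zeta p ((2 * d) * y)"
      using yd two by (intro zeta_add) (auto intro!: Fp_power)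
    finally show "zeta p ((y + d) ^ 2) * zeta p (- (y ^ 2)) = zeta p (d ^ 2) * zeta p ((2 * d) * y)" .
  qed
  also have "\<dots> = (\<Sum>d\<in>(Fp :: 'a set). zeta p (d ^ 2) * (\<Sum>y\<in>(Fp :: 'a set). zeta p ((2 * d) * y)))"
    by (subst sum.swap) (simp add: sum_distrib_left)
  also have "\<dots> = (\<Sum>d\<in>(Fp :: 'a set). if d = 0 then of_nat p else 0)"
  proof (intro sum.cong refl)
    fix d :: 'a assume "d \<in> Fp"
    hence "2 * d \<in> Fp" using Fp_of_int[of 2] by auto
    thus "zeta p (d ^ 2) * (\<Sum>y\<in>(Fp :: 'a set). zeta p ((2 * d) * y)) = (if d = 0 then of_nat p else 0)"
      by (simp only: sum_zeta_mult) simp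
  qed
  also have "\<dots> = of_nat p" by simp
  finally show ?thesis .
qed

lemma Fp_power_p_minus_1: "x \<in> Fp \<Longrightarrow> x \<noteq> 0 \<Longrightarrow> (x :: 'a) ^ (p - 1) = 1"
proof -
  assume x: "x \<in> Fp" "x \<noteq> 0"
  have "x * x ^ (p - 1) = x * 1"
    using Fp_power_p[OF x(1)] p_ge_3 by (cases p) auto
  thus ?thesis using x by (subst (asm) mult_cancel_left) simp
qed

text \<open>If p = 1 mod 4, then y^((p - 1)/2) = 1 has too few solutions to hold for every nonzero
  y; elsewhere this power is -1, the square of y^((p - 1)/4). Otherwise z^2 = -1 would give 1 = z^(p
  - 1) = (-1)^((p - 1)/2) = -1.\<close>

lemma quad_char_minus_1: "quad_char (-1 :: 'a) = (if p mod 4 = 1 then 1 else -1)"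
proof (cases "p mod 4 = 1")
  case True
  define n where "n = (p - 1) div 4"
  have n: "p - 1 = 2 * (2 * n)" using True unfolding n_def by presburger
  have n0: "n > 0" using n p_ge_3 by (cases n) auto
  have "\<exists>y\<in>Fp - {0 :: 'a}. y ^ (2 * n) \<noteq> 1"
  proof (rule ccontr)
    assume "\<not> ?thesis"
    hence *: "Fp - {0 :: 'a} \<subseteq> {y. poly (monom 1 (2 * n) - 1) y = 0}" by (auto simp: poly_monom)
    have "coeff (monom 1 (2 * n) - 1 :: 'a poly) (2 * n) = 1" using n0 by (simp add: coeff_1)
    hence nz: "monom 1 (2 * n) - 1 \<noteq> (0 :: 'a poly)" by (metis coeff_0 zero_neq_one)
    have "card (Fp - {0 :: 'a}) \<le> card {y :: 'a. poly (monom 1 (2 * n) - 1) y = 0}"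
      using * by (intro card_mono) auto
    also have "\<dots> \<le> degree (monom 1 (2 * n) - 1 :: 'a poly)"
      using nz by (rule card_poly_roots_bound)
    also have "\<dots> \<le> 2 * n" by (intro degree_diff_le) (auto simp: degree_monom_eq)
    finally show False using n n0 card_Fp by simp
  qed
  then obtain y :: 'a where y: "y \<in> Fp" "y \<noteq> 0" "y ^ (2 * n) \<noteq> 1" by blast
  have "(y ^ (2 * n)) ^ 2 = y ^ (p - 1)"
    by (subst n) (simp add: mult.commute flip: power_mult)
  also have "\<dots> = 1" using y by (intro Fp_power_p_minus_1)
  finally have "y ^ (2 * n) = -1" using y(3) power2_eq_1_iff by blast
  hence "(y ^ n) ^ 2 = -1" by (simp add: mult.commute flip: power_mult)
  moreover have "y ^ n \<in> Fp" using y by (intro Fp_power)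
  ultimately show ?thesis using True by (auto simp: quad_char_def)
next
  case False
  define n where "n = (p - 1) div 2"
  have n: "p - 1 = 2 * n" "odd n" using False odd_p p_ge_3 unfolding n_def by presburger+
  have "\<not> (\<exists>z\<in>Fp. z ^ 2 = (-1 :: 'a))"
  proof
    assume "\<exists>z\<in>Fp. z ^ 2 = (-1 :: 'a)"
    then obtain z :: 'a where z: "z \<in> Fp" "z ^ 2 = -1" by blast
    have "z \<noteq> 0" using z by auto
    hence "1 = z ^ (p - 1)" using z Fp_power_p_minus_1 by simp
    also have "\<dots> = (z ^ 2) ^ n" by (subst n(1)) (simp flip: power_mult)
    also have "\<dots> = -1" using z n by simp
    finally show False using neq_uminus[of 1] by simp
  qed
  thus ?thesis using False by (auto simp: quad_char_def)
qed

text \<open>Counting replaces multiplicativity: negation sends nonzero squares injectively to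
  nonsquares, as a quotient of square roots would otherwise be a root of -1. Both sets have (p -
  1)/2 elements, so the map is onto.\<close>

lemma quad_char_uminus:
  assumes "quad_char (-1 :: 'a) = -1" "y \<in> Fp"
  shows "quad_char (- y) = - quad_char (y :: 'a)"
proof -
  define A B where "A = {y\<in>Fp. quad_char (y :: 'a) = 1}" and "B = {y\<in>Fp. quad_char (y :: 'a) = -1}"
  have "uminus ` A \<subseteq> B"
  proof
    fix x assume "x \<in> uminus ` A"
    then obtain y where y: "y \<in> A" "x = - y" by blast
    then obtain w where w: "w \<in> Fp" "w ^ 2 = y" "y \<noteq> 0"
      by (auto simp: A_def quad_char_def split: if_splits)
    have "\<not> (\<exists>z\<in>Fp. z ^ 2 = - y)"
    proof
      assume "\<exists>z\<in>Fp. z ^ 2 = - y"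
      then obtain z where z: "z \<in> Fp" "z ^ 2 = - y" by blast
      hence "(z / w) ^ 2 = -1" using w by (simp add: power_divide)
      moreover have "z / w \<in> Fp" using z w by auto
      ultimately have "quad_char (-1 :: 'a) = 1" unfolding quad_char_def by auto
      thus False using assms by simp
    qed
    hence "quad_char (- y) = -1" using w by (auto simp: quad_char_def)
    thus "x \<in> B" using y by (simp add: A_def B_def)
  qed
  moreover have "card (uminus ` A) = card A" by (intro card_image) auto
  moreover have "card A = card B"
    using card_quad_char[of 1] card_quad_char[of "-1"] by (simp add: A_def B_def)
  ultimately have AB: "uminus ` A = B" by (intro card_seteq) auto
  consider "y = 0" | "y \<in> A" | "y \<in> B"
    using quad_char_cases[of y] assms(2) by (auto simp: A_def B_def)
  thus ?thesis
  proof cases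
    case 2
    hence "- y \<in> B" using AB by blast
    thus ?thesis using 2 by (simp add: A_def B_def)
  next
    case 3
    then obtain x where "x \<in> A" "y = - x" using AB by blast
    thus ?thesis using 3 by (simp add: A_def B_def)
  qed simp
qed

definition pstar :: int where "pstar = (if p mod 4 = 1 then int p else - int p)"

text \<open>The product of G with its conjugate is p, and conjugation replaces z^2 by -z^2. If -1 =
  i^2, the substitution z to iz shows that G is real; otherwise the character is odd and the
  conjugate is -G.\<close>

lemma gauss_sum_square: "G ^ 2 = of_int pstar"
proof (cases "p mod 4 = 1")
  case True
  then obtain i :: 'a where i: "i \<in> Fp" "i ^ 2 = -1"
    using quad_char_minus_1 by (auto simp: quad_char_def split: if_splits)
  have i0: "i \<noteq> 0" using i by auto
  have "cnj G = (\<Sum>z\<in>(Fp :: 'a set). zeta p (- (z ^ 2)))"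
    by (simp add: gauss_sum_eq_squares zeta_uminus Fp_power)
  also have "\<dots> = (\<Sum>z\<in>(Fp :: 'a set). zeta p ((i * z) ^ 2))"
    by (simp add: power_mult_distrib i)
  also have "\<dots> = (\<Sum>z\<in>(Fp :: 'a set). zeta p (z ^ 2))"
    using i i0 by (intro sum.reindex_bij_witness[of _ "\<lambda>y. y / i" "\<lambda>y. i * y"]) auto
  also have "\<dots> = G" by (simp add: gauss_sum_eq_squares)
  finally show ?thesis using gauss_sum_mult_cnj True by (simp add: power2_eq_square pstar_def)
next
  case False
  hence m: "quad_char (-1 :: 'a) = -1" by (simp add: quad_char_minus_1)
  have "cnj G = (\<Sum>y\<in>Fp. of_int (quad_char (y :: 'a)) * zeta p (- y))"
    by (simp add: gauss_sum_eq zeta_uminus)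
  also have "\<dots> = (\<Sum>y\<in>Fp. of_int (quad_char (- y :: 'a)) * zeta p y)"
    by (intro sum.reindex_bij_witness[of _ uminus uminus]) auto
  also have "\<dots> = - G"
    using m by (simp add: gauss_sum_eq quad_char_uminus sum_negf)
  finally have "cnj G = - G" .
  hence "G = - cnj G" by simp
  hence "G ^ 2 = - (G * cnj G)" by (metis mult_minus_right power2_eq_square)
  thus ?thesis using gauss_sum_mult_cnj False by (simp add: pstar_def)
qed

lemma sqrt_pstar_square: "sqrt_pstar p ^ 2 = of_int pstar"
proof -
  have "complex_of_real (sqrt (real p)) ^ 2 = of_nat p"
    by (metis of_nat_0_le_iff of_real_of_nat_eq of_real_power real_sqrt_pow2)
  thus ?thesis by (simp add: sqrt_pstar_def pstar_def power_mult_distrib)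
qed

lemma sqrt_pstar_eq: obtains \<kappa> :: int where "\<kappa> = 1 \<or> \<kappa> = -1" "sqrt_pstar p = of_int \<kappa> * G"
proof -
  have "sqrt_pstar p = G \<or> sqrt_pstar p = - G"
    using sqrt_pstar_square gauss_sum_square power2_eq_iff by metis
  thus ?thesis using that[of 1] that[of "-1"] by auto
qed

lemma pstar_abs: "\<bar>pstar\<bar> = int p"
  by (simp add: pstar_def)

text \<open>All fibres are translates of the kernel, and p of them make up p^e elements.\<close>

lemma card_tr_fibre:
  assumes "u \<noteq> 0" "j \<in> Fp"
  shows "card {x :: 'a. Tr (x * u) = j} = p ^ (e - 1)"
proof -
  have same: "card {x :: 'a. Tr (x * u) = i} = card {x :: 'a. Tr (x * u) = 0}" if i: "i \<in> Fp" for i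
  proof -
    obtain x0 where x0: "Tr (x0 * u) = i" using tr_surj_mult[OF assms(1) i] by blast
    show ?thesis
      by (rule bij_betw_same_card[of "\<lambda>x. x - x0"], rule bij_betw_byWitness[where f' = "\<lambda>x. x + x0"])
         (auto simp: tr_add tr_diff left_diff_distrib distrib_right x0)
  qed
  have "(\<Sum>i\<in>(Fp :: 'a set). \<Sum>x\<in>{x. x \<in> UNIV \<and> Tr (x * u) = i}. (1 :: nat)) = (\<Sum>x\<in>(UNIV :: 'a set). 1)"
    by (rule sum.group) auto
  hence "(\<Sum>i\<in>(Fp :: 'a set). card {x. Tr (x * u) = i}) = p ^ e"
    by (simp add: card_UNIV)
  hence "p * card {x :: 'a. Tr (x * u) = 0} = p ^ e"
    using sum.cong[OF refl same, of Fp "\<lambda>i. i"] by (simp add: card_Fp)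
  also have "\<dots> = p * p ^ (e - 1)" using e_pos by (cases e) auto
  finally show ?thesis using same[OF assms(2)] p_ge_3 by simp
qed

end

subsection \<open>Value distribution of a weakly regular bent function\<close>

locale bent_function = odd_finite_field p e ty for p e and ty :: "'a::{field,finite} itself" +
  fixes f fs :: "'a \<Rightarrow> 'a" and eps :: int
  assumes e_ge_2: "e \<ge> 2" and f_Fp [simp]: "f x \<in> Fp" and fs_Fp [simp]: "fs x \<in> Fp"
    and eps: "eps = 1 \<or> eps = -1"
    and walsh: "walsh p e f b = of_int eps * sqrt_pstar p ^ e * zeta p (fs b)"
begin

definition fibre :: "'a \<Rightarrow> 'a \<Rightarrow> nat" where "fibre b j = card {x. f x - Tr (b * x) = j}"

text \<open>A fibre deviates from its expected size by an amount that depends only on the difference to the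
  dual (lemma fibre_eq), so the zero argument in this definition is an arbitrary choice.\<close>
definition dev :: "'a \<Rightarrow> int" where "dev t = int (fibre 0 (t + fs 0)) - int p ^ (e - 1)"

lemma walsh_eq_sum_fibre: "walsh p e f b = (\<Sum>j\<in>Fp. of_nat (fibre b j) * zeta p j)"
proof -
  have "walsh p e f b = (\<Sum>j\<in>Fp. \<Sum>x\<in>{x. x \<in> UNIV \<and> f x - Tr (b * x) = j}. zeta p (f x - Tr (b * x)))"
    unfolding walsh_def by (rule sum.group[symmetric]) (auto intro: Fp_diff)
  also have "\<dots> = (\<Sum>j\<in>Fp. of_nat (fibre b j) * zeta p j)"
    unfolding fibre_def by (intro sum.cong refl) simp
  finally show ?thesis .
qed

lemma sum_fibre: "(\<Sum>j\<in>Fp. fibre b j) = p ^ e"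
proof -
  have "(\<Sum>j\<in>Fp. \<Sum>x\<in>{x. x \<in> UNIV \<and> f x - Tr (b * x) = j}. 1) = (\<Sum>x\<in>(UNIV :: 'a set). 1 :: nat)"
    by (rule sum.group) (auto intro: Fp_diff)
  thus ?thesis by (simp add: fibre_def card_UNIV)
qed

lemma sum_shift_Fp: "t \<in> Fp \<Longrightarrow> (\<Sum>j\<in>Fp. g (j - t)) = (\<Sum>j\<in>(Fp :: 'a set). g j)"
  by (rule sum.reindex_bij_witness[of _ "\<lambda>j. j + t" "\<lambda>j. j - t"]) auto

text \<open>\<open>M\<close> is any integer coefficient vector of the Walsh value at dual value 0.
  Its translate by \<open>fs b\<close> and the fibre sizes expand the same number, so they differ by
  a constant; summing over the prime field, where the fibre sizes add up to p^e, determines it. The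
  factor p avoids a division.\<close>

lemma fibre_eq_of_zeta_expansion:
  fixes M :: "'a \<Rightarrow> int"
  assumes M: "(\<Sum>j\<in>Fp. of_int (M j) * zeta p j) = of_int eps * sqrt_pstar p ^ e" and j: "j \<in> Fp"
  shows "int p * int (fibre b j) = int p ^ e + int p * M (j - fs b) - (\<Sum>i\<in>Fp. M i)"
proof -
  define K where "K = (\<lambda>j. int (fibre b j) - M (j - fs b))"
  have "of_int eps * sqrt_pstar p ^ e * zeta p (fs b) = (\<Sum>j\<in>Fp. of_int (M j) * zeta p (j + fs b))"
    by (simp add: M[symmetric] sum_distrib_right zeta_add mult.assoc)
  also have "\<dots> = (\<Sum>j\<in>Fp. of_int (M (j - fs b)) * zeta p j)"
    using sum_shift_Fp[of "fs b" "\<lambda>j. of_int (M j) * zeta p (j + fs b)"] by simp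
  finally have "(\<Sum>j\<in>Fp. of_int (K j) * zeta p j) = 0"
    using walsh[of b] walsh_eq_sum_fibre[of b]
    by (simp add: K_def left_diff_distrib sum_subtractf)
  hence const: "K i = K j" if "i \<in> Fp" for i
    using zeta_int_relation_const j that by blast
  have "(\<Sum>i\<in>Fp. K i) = int p * K j"
    using const by (simp add: card_Fp)
  moreover have "(\<Sum>i\<in>Fp. K i) = int p ^ e - (\<Sum>i\<in>Fp. M i)"
    using sum_shift_Fp[of "fs b" M] sum_fibre[of b]
    by (simp add: K_def sum_subtractf flip: of_nat_sum)
  ultimately show ?thesis by (simp add: K_def algebra_simps)
qed

lemma p_power_e: "int p ^ e = int p * int p ^ (e - 1)"
  using e_ge_2 by (cases e) auto

text \<open>For even e the power of the square root is the integer pstar^(e/2), so the coefficient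
  vector is concentrated at 0. \<open>T\<close> is this integer divided by p.\<close>

lemma fibre_even:
  assumes "even e"
  obtains T :: int where "of_int (int p * T) = sqrt_pstar p ^ e" "\<bar>T\<bar> = int p ^ (e div 2 - 1)"
    "\<And>b j. j \<in> Fp \<Longrightarrow> int (fibre b j) = int p ^ (e - 1) + eps * T * (if j = fs b then int p - 1 else -1)"
proof -
  define m where "m = e div 2 - 1"
  have e: "e = 2 * Suc m" using assms e_ge_2 by (auto simp: m_def)
  define \<sigma> :: int where "\<sigma> = (if p mod 4 = 1 then 1 else -1)"
  have ps: "pstar = int p * \<sigma>" by (simp add: pstar_def \<sigma>_def)
  define T where "T = \<sigma> * pstar ^ m"
  have pT: "int p * T = pstar ^ Suc m" by (simp add: T_def ps)
  have s: "sqrt_pstar p ^ e = of_int (int p * T)"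
    by (simp only: e power_mult sqrt_pstar_square pT of_int_power)
  define M :: "'a \<Rightarrow> int" where "M = (\<lambda>t. if t = 0 then eps * (int p * T) else 0)"
  have "(\<Sum>j\<in>Fp. of_int (M j) * zeta p j) = (\<Sum>j\<in>(Fp :: 'a set). if j = 0 then of_int (eps * (int p * T)) else 0)"
    by (intro sum.cong) (auto simp: M_def)
  also have "\<dots> = of_int eps * sqrt_pstar p ^ e" by (simp add: s)
  finally have M: "(\<Sum>j\<in>Fp. of_int (M j) * zeta p j) = of_int eps * sqrt_pstar p ^ e" .
  have sM: "(\<Sum>j\<in>Fp. M j) = eps * (int p * T)" by (simp add: M_def)
  show ?thesis
  proof (rule that[of T])
    show "of_int (int p * T) = sqrt_pstar p ^ e" by (simp only: s)
    show "\<bar>T\<bar> = int p ^ (e div 2 - 1)"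
      by (simp add: T_def abs_mult power_abs pstar_abs m_def) (simp add: \<sigma>_def)
    fix b j :: 'a assume j: "j \<in> Fp"
    have "int p * int (fibre b j) = int p * (int p ^ (e - 1) + eps * T * (if j = fs b then int p - 1 else -1))"
      using fibre_eq_of_zeta_expansion[OF M j, of b] sM
      by (cases "j = fs b") (simp_all add: M_def p_power_e algebra_simps)
    thus "int (fibre b j) = int p ^ (e - 1) + eps * T * (if j = fs b then int p - 1 else -1)"
      using p_ge_3 by (subst (asm) mult_cancel_left) simp
  qed
qed

text \<open>For odd e the power of the square root is an integer times the Gauss sum, whose
  coefficient vector is \<open>quad_char\<close>, with sum zero. Hence no constant correction
  appears.\<close>

lemma fibre_odd:
  assumes "odd e"
  obtains T \<sigma> :: int where "of_int (int p * T) = sqrt_pstar p ^ e * G" "\<bar>T\<bar> = int p ^ (e div 2)"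
    "\<sigma> = 1 \<or> \<sigma> = -1"
    "\<And>b j. j \<in> Fp \<Longrightarrow> int (fibre b j) = int p ^ (e - 1) + \<sigma> * (eps * T) * quad_char (j - fs b)"
proof -
  define m where "m = e div 2"
  have e: "e = Suc (2 * m)" using assms by (auto simp: m_def)
  obtain \<kappa> :: int where \<kappa>: "\<kappa> = 1 \<or> \<kappa> = -1" "sqrt_pstar p = of_int \<kappa> * G" by (rule sqrt_pstar_eq)
  define \<sigma> :: int where "\<sigma> = (if p mod 4 = 1 then 1 else -1)"
  have ps: "pstar = int p * \<sigma>" by (simp add: pstar_def \<sigma>_def)
  have \<sigma>: "\<sigma> = 1 \<or> \<sigma> = -1" by (simp add: \<sigma>_def)
  \<comment> \<open>The weights involve a further factor \<open>G\<close>. Then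
    \<open>G ^ 2\<close>, which is p times \<open>\<sigma>\<close>, contributes a
    \<open>\<sigma>\<close> that is absent from the coefficients of the Walsh value; this is why
    \<open>\<sigma>\<close> reappears in the fibre formula.\<close>
  define T where "T = \<kappa> * \<sigma> * pstar ^ m"
  have s: "sqrt_pstar p ^ e = of_int (\<kappa> * pstar ^ m) * G"
  proof -
    have "sqrt_pstar p ^ e = sqrt_pstar p * (sqrt_pstar p ^ 2) ^ m" by (simp add: e power_mult)
    thus ?thesis by (simp only: sqrt_pstar_square) (simp add: \<kappa>(2))
  qed
  have "sqrt_pstar p ^ e * G = of_int (\<kappa> * pstar ^ m) * G ^ 2"
    by (simp add: s power2_eq_square)
  also have "\<dots> = of_int (int p * T)" by (simp add: gauss_sum_square T_def ps)
  finally have sG: "sqrt_pstar p ^ e * G = of_int (int p * T)" .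
  define M :: "'a \<Rightarrow> int" where "M = (\<lambda>t. eps * (\<kappa> * pstar ^ m) * quad_char t)"
  have M: "(\<Sum>j\<in>Fp. of_int (M j) * zeta p j) = of_int eps * sqrt_pstar p ^ e"
    by (simp add: s M_def gauss_sum_eq sum_distrib_left mult.assoc)
  have sM: "(\<Sum>j\<in>Fp. M j) = 0"
    by (simp add: M_def sum_quad_char flip: sum_distrib_left)
  have MT: "M t = \<sigma> * (eps * T) * quad_char t" for t
    using \<sigma> by (auto simp: M_def T_def)
  show ?thesis
  proof (rule that[of T \<sigma>])
    show "of_int (int p * T) = sqrt_pstar p ^ e * G" by (simp only: sG)
    show "\<bar>T\<bar> = int p ^ (e div 2)"
      using \<kappa>(1) \<sigma> by (auto simp: T_def abs_mult power_abs pstar_abs m_def)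
    show "\<sigma> = 1 \<or> \<sigma> = -1" by (rule \<sigma>)
    fix b j :: 'a assume j: "j \<in> Fp"
    have "int p * int (fibre b j) = int p * (int p ^ (e - 1) + M (j - fs b))"
      using fibre_eq_of_zeta_expansion[OF M j, of b] sM by (simp add: p_power_e algebra_simps)
    hence "int (fibre b j) = int p ^ (e - 1) + M (j - fs b)"
      using p_ge_3 by (subst (asm) mult_cancel_left) simp
    thus "int (fibre b j) = int p ^ (e - 1) + \<sigma> * (eps * T) * quad_char (j - fs b)"
      by (simp only: MT)
  qed
qed

lemma dev_even:
  assumes "even e"
  obtains T :: int where "of_int (int p * T) = sqrt_pstar p ^ e" "\<bar>T\<bar> = int p ^ (e div 2 - 1)"
    "\<And>t. t \<in> Fp \<Longrightarrow> dev t = eps * T * (if t = 0 then int p - 1 else -1)"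
proof -
  obtain T :: int where T: "of_int (int p * T) = sqrt_pstar p ^ e" "\<bar>T\<bar> = int p ^ (e div 2 - 1)"
    "\<And>b j. j \<in> Fp \<Longrightarrow> int (fibre b j) = int p ^ (e - 1) + eps * T * (if j = fs b then int p - 1 else -1)"
    using fibre_even[OF assms] by metis
  have "dev t = eps * T * (if t = 0 then int p - 1 else -1)" if "t \<in> Fp" for t
    unfolding dev_def using that by (subst T(3)) auto
  thus ?thesis using that T by blast
qed

lemma dev_odd:
  assumes "odd e"
  obtains T \<sigma> :: int where "of_int (int p * T) = sqrt_pstar p ^ e * G" "\<bar>T\<bar> = int p ^ (e div 2)"
    "\<sigma> = 1 \<or> \<sigma> = -1" "\<And>t. t \<in> Fp \<Longrightarrow> dev t = \<sigma> * (eps * T) * quad_char t"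
proof -
  obtain T \<sigma> :: int where T: "of_int (int p * T) = sqrt_pstar p ^ e * G" "\<bar>T\<bar> = int p ^ (e div 2)"
    "\<sigma> = 1 \<or> \<sigma> = -1"
    "\<And>b j. j \<in> Fp \<Longrightarrow> int (fibre b j) = int p ^ (e - 1) + \<sigma> * (eps * T) * quad_char (j - fs b)"
    using fibre_odd[OF assms] by metis
  have "dev t = \<sigma> * (eps * T) * quad_char t" if "t \<in> Fp" for t
    unfolding dev_def using that by (subst T(4)) auto
  thus ?thesis using that T by blast
qed

text \<open>This form lets the zeros of codewords be counted without regard to the parity of
  e.\<close>

lemma fibre_eq:
  assumes "j \<in> Fp"
  shows "int (fibre b j) = int p ^ (e - 1) + dev (j - fs b)"
proof (cases "even e")
  case True
  obtain T :: int where T: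
    "\<And>b j. j \<in> Fp \<Longrightarrow> int (fibre b j) = int p ^ (e - 1) + eps * T * (if j = fs b then int p - 1 else -1)"
    using fibre_even[OF True] by metis
  have "j - fs b + fs 0 \<in> Fp" using assms by (intro Fp_add Fp_diff fs_Fp)
  thus ?thesis unfolding dev_def using assms T[of j b] T[of "j - fs b + fs 0" 0] by auto
next
  case False
  obtain T \<sigma> :: int where T:
    "\<And>b j. j \<in> Fp \<Longrightarrow> int (fibre b j) = int p ^ (e - 1) + \<sigma> * (eps * T) * quad_char (j - fs b)"
    using fibre_odd[OF False] by metis
  have "j - fs b + fs 0 \<in> Fp" using assms by (intro Fp_add Fp_diff fs_Fp)
  thus ?thesis unfolding dev_def using assms T[of j b] T[of "j - fs b + fs 0" 0] by auto
qed

text \<open>Words with a nonzero thus have weight strictly between p^e - 2p^(e - 1) and p^e. This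
  keeps them apart from the zero word and from the nonzero constants.\<close>

lemma abs_dev_less:
  assumes "t \<in> Fp"
  shows "\<bar>dev t\<bar> < int p ^ (e - 1)"
proof (cases "even e")
  case True
  obtain T :: int where T: "\<bar>T\<bar> = int p ^ (e div 2 - 1)"
    "\<And>t. t \<in> Fp \<Longrightarrow> dev t = eps * T * (if t = 0 then int p - 1 else -1)"
    using dev_even[OF True] by metis
  have "\<bar>dev t\<bar> \<le> int p ^ (e div 2 - 1) * (int p - 1)"
    using eps p_ge_3 T(2)[OF assms] by (auto simp: abs_mult T(1))
  also have "\<dots> < int p ^ (e div 2 - 1) * int p" using p_ge_3 by simp
  also have "\<dots> = int p ^ Suc (e div 2 - 1)" by simp
  also have "\<dots> \<le> int p ^ (e - 1)" using p_ge_3 e_ge_2 True by (intro power_increasing) auto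
  finally show ?thesis .
next
  case False
  obtain T \<sigma> :: int where T: "\<bar>T\<bar> = int p ^ (e div 2)"
    "\<sigma> = 1 \<or> \<sigma> = -1" "\<And>t. t \<in> Fp \<Longrightarrow> dev t = \<sigma> * (eps * T) * quad_char t"
    using dev_odd[OF False] by metis
  have "\<bar>dev t\<bar> \<le> int p ^ (e div 2)"
    using eps T(2) T(3)[OF assms] quad_char_cases[of t] by (auto simp: abs_mult T(1))
  also have "\<dots> < int p ^ (e - 1)"
    using p_ge_3 e_ge_2 False by (intro power_strict_increasing) presburger+
  finally show ?thesis .
qed

text \<open>From e = 3 on, the power of p that is the absolute value of \<open>T\<close> has
  positive exponent; for e = 2 it is 1.\<close>

lemma p_dvd_dev:
  assumes "t \<in> Fp" "e \<ge> 3"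
  shows "int p dvd dev t"
proof (cases "even e")
  case True
  obtain T :: int where T: "\<bar>T\<bar> = int p ^ (e div 2 - 1)"
    "\<And>t. t \<in> Fp \<Longrightarrow> dev t = eps * T * (if t = 0 then int p - 1 else -1)"
    using dev_even[OF True] by metis
  have "e div 2 - 1 > 0" using True assms by presburger
  hence "int p dvd int p ^ (e div 2 - 1)" by (rule dvd_power[OF disjI1])
  hence "int p dvd T" using T(1) by (metis dvd_abs_iff)
  thus ?thesis using T(2)[OF assms(1)] by (simp add: dvd_mult dvd_mult2)
next
  case False
  obtain T \<sigma> :: int where T: "\<bar>T\<bar> = int p ^ (e div 2)"
    "\<sigma> = 1 \<or> \<sigma> = -1" "\<And>t. t \<in> Fp \<Longrightarrow> dev t = \<sigma> * (eps * T) * quad_char t"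
    using dev_odd[OF False] by metis
  have "e div 2 > 0" using False assms by presburger
  hence "int p dvd int p ^ (e div 2)" by (rule dvd_power[OF disjI1])
  hence "int p dvd T" using T(1) by (metis dvd_abs_iff)
  thus ?thesis using T(3)[OF assms(1)] by (simp add: dvd_mult dvd_mult2)
qed

section \<open>Codewords, their zeros and weights\<close>

definition word :: "'a \<Rightarrow> 'a \<Rightarrow> 'a \<Rightarrow> 'a \<Rightarrow> 'a" where
  "word a b c = (\<lambda>x. a * f x + Tr (b * x) + c)"

lemma word_Fp [simp]: "a \<in> Fp \<Longrightarrow> c \<in> Fp \<Longrightarrow> word a b c x \<in> Fp"
  unfolding word_def by (intro Fp_add Fp_mult tr_in_Fp f_Fp)

lemma word_0 [simp]: "word 0 0 0 x = 0"
  by (simp add: word_def)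

lemma word_add: "word a b c x + word a' b' c' x = word (a + a') (b + b') (c + c') x"
  by (simp add: word_def tr_add algebra_simps)

lemma word_diff: "word a b c x - word a' b' c' x = word (a - a') (b - b') (c - c') x"
  by (simp add: word_def tr_diff algebra_simps)

lemma word_scale: "k \<in> Fp \<Longrightarrow> k * word a b c x = word (k * a) (k * b) (k * c) x"
  using tr_scale[of k "b * x"] by (simp add: word_def algebra_simps)

lemma card_zeros_word:
  assumes "a \<in> Fp" "a \<noteq> 0" "c \<in> Fp"
  shows "int (card {x. word a b c x = 0}) = int p ^ (e - 1) + dev (- c / a - fs (- b / a))"
proof -
  have "word a b c x = 0 \<longleftrightarrow> f x - Tr (- b / a * x) = - c / a" for x
  proof -
    have "- b / a * x = (- inverse a) * (b * x)" by (simp add: divide_inverse)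
    hence T: "Tr (- b / a * x) = - inverse a * Tr (b * x)"
      using assms by (simp only: tr_scale Fp_uminus Fp_inverse)
    have "word a b c x = a * (f x - Tr (- b / a * x) - - c / a)"
      unfolding T using assms(2) by (simp add: word_def field_simps)
    thus ?thesis using assms(2) by (simp only: mult_eq_0_iff right_minus_eq) simp
  qed
  hence "card {x. word a b c x = 0} = fibre (- b / a) (- c / a)"
    by (simp add: fibre_def)
  thus ?thesis using assms by (simp add: fibre_eq Fp_divide)
qed

lemma card_zeros_trace_word:
  assumes "b \<noteq> 0" "c \<in> Fp"
  shows "card {x. word 0 b c x = 0} = p ^ (e - 1)"
proof -
  have "{x. word 0 b c x = 0} = {x. Tr (x * b) = - c}"
    by (auto simp: word_def mult.commute eq_neg_iff_add_eq_0)
  thus ?thesis using card_tr_fibre[OF assms(1), of "- c"] assms by simp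
qed

lemma wt_eq_card_zeros: "int (wt v) = int p ^ e - int (card {x :: 'a. v x = (0 :: 'a)})"
proof -
  have "card {x. v x = 0} + card {x. v x \<noteq> 0} = card ({x. v x = 0} \<union> {x. v x \<noteq> 0})"
    by (rule card_Un_disjoint[symmetric]) auto
  also have "{x. v x = 0} \<union> {x. v x \<noteq> 0} = UNIV" by auto
  finally have "int (card {x. v x = 0} + card {x. v x \<noteq> 0}) = int (p ^ e)" by (simp only: card_UNIV)
  thus ?thesis by (simp add: wt_def)
qed

lemma wt_word:
  assumes "a \<in> Fp" "a \<noteq> 0" "c \<in> Fp"
  shows "int (wt (word a b c)) = int p ^ e - int p ^ (e - 1) - dev (- c / a - fs (- b / a))"
  using card_zeros_word[OF assms, of b] by (simp add: wt_eq_card_zeros)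

lemma wt_trace_word:
  assumes "b \<noteq> 0" "c \<in> Fp"
  shows "int (wt (word 0 b c)) = int p ^ e - int p ^ (e - 1)"
  using card_zeros_trace_word[OF assms] by (simp add: wt_eq_card_zeros)

lemma wt_const_word: "c \<noteq> 0 \<Longrightarrow> int (wt (word 0 0 c)) = int p ^ e"
  by (simp add: wt_eq_card_zeros word_def)

lemma wt_0 [simp]: "wt (word 0 0 0) = 0"
  by (simp add: wt_def)

lemma p_power_e_gt: "2 * int p ^ (e - 1) < int p ^ e"
  using p_ge_3 by (simp add: p_power_e)

text \<open>By linearity this makes the parametrisation by (a, b, c) injective, which gives p^(e +
  2) codewords and hence the dimension.\<close>

lemma wt_word_pos:
  assumes "a \<in> Fp" "c \<in> Fp" "(a, b, c) \<noteq> (0, 0, 0)"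
  shows "wt (word a b c) > 0"
proof -
  have P: "int p ^ (e - 1) > 0" using p_ge_3 by simp
  consider "a \<noteq> 0" | "a = 0" "b \<noteq> 0" | "a = 0" "b = 0" "c \<noteq> 0" using assms by auto
  hence "int (wt (word a b c)) > 0"
  proof cases
    case 1
    have "- c / a - fs (- b / a) \<in> Fp" using assms by (intro Fp_diff Fp_divide) auto
    thus ?thesis
      using wt_word[OF assms(1) 1 assms(2), of b] p_power_e_gt abs_dev_less by fastforce
  next
    case 2
    hence "int (wt (word a b c)) = int p ^ e - int p ^ (e - 1)" using wt_trace_word[of b c] assms by simp
    thus ?thesis using p_power_e_gt P by linarith
  next
    case 3
    hence "int (wt (word a b c)) = int p ^ e" using wt_const_word[of c] by simp
    thus ?thesis using p_power_e_gt P by linarith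
  qed
  thus ?thesis by simp
qed

lemma word_inject:
  assumes "a \<in> Fp" "c \<in> Fp" "a' \<in> Fp" "c' \<in> Fp" "word a b c = word a' b' c'"
  shows "a = a' \<and> b = b' \<and> c = c'"
proof (rule ccontr)
  assume "\<not> ?thesis"
  hence "wt (word (a - a') (b - b') (c - c')) > 0"
    using assms by (intro wt_word_pos Fp_diff) auto
  moreover have "word (a - a') (b - b') (c - c') x = 0" for x
    using word_diff[of a b c x a' b' c'] assms(5) by simp
  ultimately show False by (simp add: wt_def)
qed

abbreviation C :: "('a \<Rightarrow> 'a) set" where "C \<equiv> code_Cf p e f"

definition params :: "('a \<times> 'a \<times> 'a) set" where "params = Fp \<times> UNIV \<times> Fp"

lemma code_Cf_eq: "C = (\<lambda>(a, b, c). word a b c) ` params"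
proof -
  have "C = {word a b c | a b c. a \<in> Fp \<and> c \<in> Fp}"
    by (simp add: code_Cf_def word_def)
  also have "\<dots> = (\<lambda>(a, b, c). word a b c) ` params"
    by (force simp: params_def)
  finally show ?thesis .
qed

lemma code_CfE:
  assumes "v \<in> C"
  obtains a b c where "a \<in> Fp" "c \<in> Fp" "v = word a b c"
  using assms unfolding code_Cf_eq by (auto simp: params_def)

lemma word_in_code: "a \<in> Fp \<Longrightarrow> c \<in> Fp \<Longrightarrow> word a b c \<in> C"
  unfolding code_Cf_eq by (force simp: params_def)

lemma inj_on_word: "inj_on (\<lambda>(a, b, c). word a b c) params"
proof (rule inj_onI)
  fix x y assume "x \<in> params" "y \<in> params" "(\<lambda>(a, b, c). word a b c) x = (\<lambda>(a, b, c). word a b c) y"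
  thus "x = y" using word_inject
    by (cases x; cases y) (simp add: params_def; metis)
qed

lemma card_code: "card C = p ^ (e + 2)"
  using card_image[OF inj_on_word] by (simp add: code_Cf_eq params_def card_cartesian_product card_Fp card_UNIV)

lemma linear_code_C: "linear_code C"
  unfolding linear_code_def
proof (intro conjI ballI)
  show "C \<subseteq> ambient" by (auto simp: ambient_def elim!: code_CfE)
  have "(\<lambda>x. 0) = word 0 0 0" by (simp add: fun_eq_iff)
  thus "(\<lambda>x. 0) \<in> C" using word_in_code[of 0 0 0] by simp
next
  fix u v assume "u \<in> C" "v \<in> C"
  then obtain a b c a' b' c' where *: "u = word a b c" "v = word a' b' c'" "a \<in> Fp" "c \<in> Fp" "a' \<in> Fp" "c' \<in> Fp"
    by (metis code_CfE)
  hence "(\<lambda>x. u x + v x) = word (a + a') (b + b') (c + c')" by (simp add: word_add)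
  thus "(\<lambda>x. u x + v x) \<in> C" using * by (simp add: Fp_add word_in_code)
next
  fix k :: 'a and v assume k: "k \<in> Fp" and "v \<in> C"
  then obtain a b c where *: "v = word a b c" "a \<in> Fp" "c \<in> Fp"
    by (metis code_CfE)
  hence "(\<lambda>x. k * v x) = word (k * a) (k * b) (k * c)" using k by (simp add: word_scale)
  thus "(\<lambda>x. k * v x) \<in> C" using * k by (simp add: Fp_mult word_in_code)
qed

end

subsection \<open>Linear codes over the prime field\<close>

lemma min_dist_eqI:
  fixes K :: "('a::{field,finite} \<Rightarrow> 'a) set"
  assumes "\<And>c. c \<in> K \<Longrightarrow> c \<noteq> (\<lambda>x. 0) \<Longrightarrow> d \<le> wt c" and "c \<in> K" "c \<noteq> (\<lambda>x. 0)" "wt c = d"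
  shows "min_dist K = d"
  unfolding min_dist_def by (rule Min_eqI) (use assms in auto)

context odd_finite_field
begin

text \<open>As introduction rules these make proof search over subsets of the prime field diverge.\<close>
declare Fp_add [rule del] Fp_mult [rule del] Fp_diff [rule del] Fp_sum [rule del] Fp_power [rule del]
  Fp_inverse [rule del] Fp_divide [rule del]

lemma linear_code_0: "linear_code K \<Longrightarrow> (\<lambda>x. 0 :: 'a) \<in> K"
  and linear_code_add: "linear_code K \<Longrightarrow> u \<in> K \<Longrightarrow> v \<in> K \<Longrightarrow> (\<lambda>x. u x + v x :: 'a) \<in> K"
  and linear_code_scale: "linear_code K \<Longrightarrow> a \<in> Fp \<Longrightarrow> v \<in> K \<Longrightarrow> (\<lambda>x. a * v x :: 'a) \<in> K"
  and linear_code_Fp: "linear_code K \<Longrightarrow> v \<in> K \<Longrightarrow> v x \<in> (Fp :: 'a set)"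
  by (auto simp: linear_code_def ambient_def)

lemma linear_code_diff:
  assumes "linear_code K" "u \<in> K" "v \<in> K"
  shows "(\<lambda>x. u x - v x :: 'a) \<in> K"
  using linear_code_add[OF assms(1,2) linear_code_scale[OF assms(1) _ assms(3), of "-1"]] by simp

lemma linear_code_sum:
  assumes "linear_code K" "B \<subseteq> K" "\<And>v. v \<in> B \<Longrightarrow> g v \<in> Fp"
  shows "(\<lambda>x. \<Sum>v\<in>B. g v * v x :: 'a) \<in> K"
proof -
  have "finite B" by simp
  thus ?thesis using assms(2,3)
  proof (induction B rule: finite_induct)
    case (insert v B)
    thus ?case using assms(1) by (simp add: linear_code_add linear_code_scale)
  qed (simp add: linear_code_0 assms)
qed

text \<open>Coefficient functions are taken extensional on \<open>B\<close>, since values outside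
  \<open>B\<close> would spoil uniqueness; independence then makes evaluation injective.\<close>

lemma card_fp_span:
  assumes "fp_indep B"
  shows "card (fp_span B) = p ^ card (B :: ('a \<Rightarrow> 'a) set)"
proof -
  define F where "F = (\<lambda>(g :: ('a \<Rightarrow> 'a) \<Rightarrow> 'a) x. \<Sum>v\<in>B. g v * v x)"
  have "fp_span B = F ` (B \<rightarrow>\<^sub>E Fp)"
  proof (intro equalityI subsetI)
    fix w assume "w \<in> fp_span B"
    then obtain g where g: "\<forall>v\<in>B. g v \<in> Fp" "w = F g" by (auto simp: fp_span_def F_def)
    moreover have "F (restrict g B) = F g" by (simp add: F_def)
    moreover have "restrict g B \<in> B \<rightarrow>\<^sub>E Fp" using g by simp
    ultimately show "w \<in> F ` (B \<rightarrow>\<^sub>E Fp)" by (metis image_eqI)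
  next
    fix w assume "w \<in> F ` (B \<rightarrow>\<^sub>E Fp)"
    then obtain g where "g \<in> B \<rightarrow>\<^sub>E Fp" "w = F g" by blast
    thus "w \<in> fp_span B" unfolding fp_span_def F_def by (auto dest: PiE_mem)
  qed
  moreover have "inj_on F (B \<rightarrow>\<^sub>E Fp)"
  proof (rule inj_onI)
    fix g h assume gh: "g \<in> B \<rightarrow>\<^sub>E Fp" "h \<in> B \<rightarrow>\<^sub>E Fp" "F g = F h"
    have mem: "\<forall>v\<in>B. g v - h v \<in> Fp" using gh by (auto intro: Fp_diff dest: PiE_mem)
    moreover have "(\<Sum>v\<in>B. (g v - h v) * v x) = 0" for x
      using fun_cong[OF gh(3), of x] by (simp add: F_def left_diff_distrib sum_subtractf)
    ultimately have "\<forall>v\<in>B. g v - h v = 0"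
      using assms[unfolded fp_indep_def, rule_format, of "\<lambda>v. g v - h v"] by blast
    thus "g = h" using gh by (intro PiE_ext) auto
  qed
  ultimately show ?thesis by (simp add: card_image card_PiE card_Fp)
qed

text \<open>An independent subset of largest cardinality spans: adjoining another codeword creates a
  relation in which that word has a nonzero coefficient, so it can be solved for.\<close>

lemma ex_fp_basis:
  assumes "linear_code (K :: ('a \<Rightarrow> 'a) set)"
  shows "\<exists>B. B \<subseteq> K \<and> fp_indep B \<and> fp_span B = K"
proof -
  have "\<exists>B. (B \<subseteq> K \<and> fp_indep B) \<and> (\<forall>B'. B' \<subseteq> K \<and> fp_indep B' \<longrightarrow> card B' \<le> card B)"
    by (rule ex_has_greatest_nat[where k = "{}" and b = "Suc (card (UNIV :: ('a \<Rightarrow> 'a) set))"])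
       (auto simp: fp_indep_def less_Suc_eq_le intro: card_mono)
  then obtain B where B: "B \<subseteq> K" "fp_indep B"
    and max: "\<And>B'. B' \<subseteq> K \<Longrightarrow> fp_indep B' \<Longrightarrow> card B' \<le> card B" by blast
  have "fp_span B \<subseteq> K"
    using assms B(1) unfolding fp_span_def by (auto intro: linear_code_sum)
  moreover have "K \<subseteq> fp_span B"
  proof
    fix v assume v: "v \<in> K"
    show "v \<in> fp_span B"
    proof (cases "v \<in> B")
      case True
      define g where "g = (\<lambda>u. if u = v then 1 else 0 :: 'a)"
      have "v = (\<lambda>x. \<Sum>u\<in>B. g u * u x)"
        using True by (intro ext) (simp add: g_def if_distrib[of "\<lambda>t. t * _"] cong: if_cong)
      moreover have "\<forall>u\<in>B. g u \<in> Fp" by (simp add: g_def)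
      ultimately show ?thesis unfolding fp_span_def by blast
    next
      case False
      have "\<not> fp_indep (insert v B)"
        using max[of "insert v B"] B v False by auto
      then obtain g where g: "\<forall>u\<in>insert v B. g u \<in> Fp" "\<And>x. (\<Sum>u\<in>insert v B. g u * u x) = 0"
        and g0: "\<exists>u\<in>insert v B. g u \<noteq> 0"
        unfolding fp_indep_def by blast
      have rel: "g v * v x + (\<Sum>u\<in>B. g u * u x) = 0" for x using g(2)[of x] False by simp
      have gv: "g v \<noteq> 0"
      proof
        assume "g v = 0"
        hence "\<forall>x. (\<Sum>u\<in>B. g u * u x) = 0" using rel by simp
        hence "\<forall>u\<in>B. g u = 0" using B(2) g(1) unfolding fp_indep_def by blast
        thus False using g0 \<open>g v = 0\<close> by blast
      qed
      have "v x = (\<Sum>u\<in>B. (- g u / g v) * u x)" for x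
      proof -
        have "v x = - (\<Sum>u\<in>B. g u * u x) / g v"
          using eq_neg_iff_add_eq_0[THEN iffD2, OF rel[of x]] gv by (simp add: field_simps)
        also have "\<dots> = (\<Sum>u\<in>B. (- g u / g v) * u x)"
          by (simp add: sum_negf sum_divide_distrib)
        finally show ?thesis .
      qed
      hence "v = (\<lambda>x. \<Sum>u\<in>B. (- g u / g v) * u x)" by (rule ext)
      moreover have "\<forall>u\<in>B. - g u / g v \<in> Fp" using g(1) by (auto intro!: Fp_divide)
      ultimately show ?thesis unfolding fp_span_def by (intro CollectI exI[of _ "\<lambda>u. - g u / g v"] conjI)
    qed
  qed
  ultimately show ?thesis using B by blast
qed

text \<open>The description by \<open>THE\<close> is resolved by counting: a basis \<open>B\<close>
  spans p^(card B) words, so all bases have the same size.\<close>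

lemma code_dim_eq:
  assumes "linear_code (K :: ('a \<Rightarrow> 'a) set)" "card K = p ^ k"
  shows "code_dim K = k"
proof -
  have card: "card B = k" if "fp_indep B" "fp_span B = K" for B
    using card_fp_span[OF that(1)] that(2) assms(2) p_ge_3 power_inject_exp[of p "card B" k] by simp
  show ?thesis unfolding code_dim_def
  proof (rule the_equality)
    obtain B where B: "B \<subseteq> K" "fp_indep B" "fp_span B = K" using ex_fp_basis[OF assms(1)] by blast
    thus "\<exists>B. finite B \<and> B \<subseteq> K \<and> fp_indep B \<and> fp_span B = K \<and> card B = k"
      using card[OF B(2,3)] by (intro exI[of _ B]) simp
  next
    fix l assume "\<exists>B. finite B \<and> B \<subseteq> K \<and> fp_indep B \<and> fp_span B = K \<and> card B = l"
    thus "l = k" using card by blast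
  qed
qed

lemma linear_code_ambient: "linear_code (ambient :: ('a \<Rightarrow> 'a) set)"
  by (auto simp: linear_code_def ambient_def intro: Fp_add Fp_mult)

lemma card_ambient: "card (ambient :: ('a \<Rightarrow> 'a) set) = p ^ p ^ e"
proof -
  have "(ambient :: ('a \<Rightarrow> 'a) set) = PiE UNIV (\<lambda>_. Fp)" by (auto simp: ambient_def)
  thus ?thesis using card_PiE[of "UNIV :: 'a set" "\<lambda>_. Fp :: 'a set"] by (simp add: card_Fp card_UNIV)
qed

lemma linear_code_dual: "linear_code (dual_code (K :: ('a \<Rightarrow> 'a) set))"
  by (auto simp: linear_code_def dual_code_def ambient_def distrib_right sum.distrib mult.assoc
      intro: Fp_add Fp_mult simp flip: sum_distrib_left)

text \<open>Orthogonality of characters: translation by a word w with nonzero value multiplies the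
  sum by \<open>zeta p (\<phi> w)\<close>, which is not 1.\<close>

lemma sum_zeta_linear_code:
  assumes K: "linear_code (K :: ('a \<Rightarrow> 'a) set)" and \<phi>: "\<And>v. v \<in> K \<Longrightarrow> \<phi> v \<in> (Fp :: 'a set)"
    and add: "\<And>u v. u \<in> K \<Longrightarrow> v \<in> K \<Longrightarrow> \<phi> (\<lambda>x. u x + v x) = \<phi> u + \<phi> v"
  shows "(\<Sum>v\<in>K. zeta p (\<phi> v)) = (if \<forall>v\<in>K. \<phi> v = 0 then of_nat (card K) else 0)"
proof (cases "\<forall>v\<in>K. \<phi> v = 0")
  case False
  then obtain w where w: "w \<in> K" "\<phi> w \<noteq> 0" by blast
  have "(\<Sum>v\<in>K. zeta p (\<phi> v)) = (\<Sum>v\<in>K. zeta p (\<phi> (\<lambda>x. v x + w x)))"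
    using K w by (intro sum.reindex_bij_witness[of _ "\<lambda>v x. v x + w x" "\<lambda>v x. v x - w x"])
      (auto intro: linear_code_add linear_code_diff)
  also have "\<dots> = (\<Sum>v\<in>K. zeta p (\<phi> v)) * zeta p (\<phi> w)"
    using w by (simp add: add zeta_add \<phi> sum_distrib_right)
  finally have "(\<Sum>v\<in>K. zeta p (\<phi> v)) * (1 - zeta p (\<phi> w)) = 0"
    by (simp add: right_diff_distrib)
  thus ?thesis using False w \<phi>[OF w(1)] by (auto simp: zeta_eq_1_iff)
qed simp

text \<open>The character sum over all pairs of a vector and a codeword is evaluated in both orders.
  Summing over codewords first detects the dual; summing over vectors first leaves only the zero
  codeword.\<close>

lemma card_dual_code:
  assumes K: "linear_code (K :: ('a \<Rightarrow> 'a) set)"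
  shows "card K * card (dual_code K) = p ^ p ^ e"
proof -
  define \<phi> where "\<phi> = (\<lambda>(v :: 'a \<Rightarrow> 'a) c. \<Sum>x\<in>UNIV. v x * c x)"
  have "(\<Sum>v\<in>ambient. \<Sum>c\<in>K. zeta p (\<phi> v c)) = (\<Sum>v\<in>ambient. if v \<in> dual_code K then of_nat (card K) else 0)"
  proof (intro sum.cong refl)
    fix v :: "'a \<Rightarrow> 'a" assume v: "v \<in> ambient"
    have "(\<Sum>c\<in>K. zeta p (\<phi> v c)) = (if \<forall>c\<in>K. \<phi> v c = 0 then of_nat (card K) else 0)"
    proof (rule sum_zeta_linear_code[OF K])
      fix c assume c: "c \<in> K"
      show "\<phi> v c \<in> Fp"
        using linear_code_Fp[OF K c] v unfolding \<phi>_def ambient_def by (intro Fp_sum Fp_mult) auto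
    qed (simp add: \<phi>_def distrib_left sum.distrib)
    thus "(\<Sum>c\<in>K. zeta p (\<phi> v c)) = (if v \<in> dual_code K then of_nat (card K) else 0)"
      using v by (simp add: dual_code_def \<phi>_def)
  qed
  also have "\<dots> = of_nat (card K * card (dual_code K))"
  proof -
    have "{v \<in> ambient. v \<in> dual_code K} = dual_code K" by (auto simp: dual_code_def)
    thus ?thesis by (simp add: sum.If_cases Int_def)
  qed
  finally have 1: "(\<Sum>v\<in>ambient. \<Sum>c\<in>K. zeta p (\<phi> v c)) = of_nat (card K * card (dual_code K))" .
  have "(\<Sum>v\<in>ambient. zeta p (\<phi> v c)) = (if c = (\<lambda>x. 0) then of_nat (p ^ p ^ e) else 0)" if c: "c \<in> K" for c
  proof -
    have "(\<Sum>v\<in>ambient. zeta p (\<phi> v c)) = (if \<forall>v\<in>ambient. \<phi> v c = 0 then of_nat (card (ambient :: ('a \<Rightarrow> 'a) set)) else 0)"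
    proof (rule sum_zeta_linear_code[OF linear_code_ambient])
      fix v :: "'a \<Rightarrow> 'a" assume "v \<in> ambient"
      thus "\<phi> v c \<in> Fp"
        using linear_code_Fp[OF K c] unfolding \<phi>_def ambient_def by (intro Fp_sum Fp_mult) auto
    qed (simp add: \<phi>_def distrib_right sum.distrib)
    moreover have "(\<forall>v\<in>ambient. \<phi> v c = 0) \<longleftrightarrow> c = (\<lambda>x. 0)"
    proof
      assume *: "\<forall>v\<in>ambient. \<phi> v c = 0"
      show "c = (\<lambda>x. 0)"
      proof
        fix y
        have "(\<lambda>x. if x = y then 1 else 0 :: 'a) \<in> ambient" by (simp add: ambient_def)
        hence "\<phi> (\<lambda>x. if x = y then 1 else 0) c = 0" using * by blast
        thus "c y = 0" by (simp add: \<phi>_def if_distrib[of "\<lambda>t. t * _"] cong: if_cong)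
      qed
    qed (simp add: \<phi>_def)
    ultimately show ?thesis by (simp only: card_ambient)
  qed
  hence "(\<Sum>c\<in>K. \<Sum>v\<in>ambient. zeta p (\<phi> v c)) = of_nat (p ^ p ^ e)"
    using linear_code_0[OF K] by simp
  moreover have "(\<Sum>c\<in>K. \<Sum>v\<in>ambient. zeta p (\<phi> v c)) = (\<Sum>v\<in>ambient. \<Sum>c\<in>K. zeta p (\<phi> v c))"
    by (rule sum.swap)
  ultimately have "(of_nat (card K * card (dual_code K)) :: complex) = of_nat (p ^ p ^ e)"
    using 1 by simp
  thus ?thesis by (simp only: of_nat_eq_iff)
qed

lemma code_dim_dual:
  assumes "linear_code (K :: ('a \<Rightarrow> 'a) set)" "card K = p ^ k"
  shows "code_dim (dual_code K) = p ^ e - k"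
proof (rule code_dim_eq[OF linear_code_dual])
  have eq: "p ^ k * card (dual_code K) = p ^ p ^ e" using card_dual_code[OF assms(1)] assms(2) by simp
  \<comment> \<open>Guards the natural-number subtraction in \<open>p ^ e - k\<close> against
    truncation.\<close>
  have "card K \<le> card (ambient :: ('a \<Rightarrow> 'a) set)"
    using assms(1) by (intro card_mono) (auto simp: linear_code_def)
  hence "k \<le> p ^ e" using assms(2) p_ge_3 by (simp add: card_ambient power_increasing_iff)
  hence "p ^ k * card (dual_code K) = p ^ k * p ^ (p ^ e - k)"
    using eq by (simp flip: power_add)
  thus "card (dual_code K) = p ^ (p ^ e - k)" using p_ge_3 by simp
qed

text \<open>Each nonempty fibre translates into the kernel, and there are at most p fibres. It will
  bound from below the number of planes through a given line and a given point.\<close>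

lemma card_le_card_kernel:
  fixes D :: "'b::{ab_group_add,finite} set" and \<phi> :: "'b \<Rightarrow> 'a"
  assumes diff: "\<And>u v. u \<in> D \<Longrightarrow> v \<in> D \<Longrightarrow> u - v \<in> D"
    and \<phi>_diff: "\<And>u v. u \<in> D \<Longrightarrow> v \<in> D \<Longrightarrow> \<phi> (u - v) = \<phi> u - \<phi> v"
    and \<phi>_Fp: "\<And>u. u \<in> D \<Longrightarrow> \<phi> u \<in> Fp"
  shows "card D \<le> p * card {u\<in>D. \<phi> u = 0}"
proof -
  have "card {u\<in>D. \<phi> u = j} \<le> card {u\<in>D. \<phi> u = 0}" for j
  proof (cases "{u\<in>D. \<phi> u = j} = {}")
    case False
    then obtain w where w: "w \<in> D" "\<phi> w = j" by blast
    show ?thesis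
      by (rule card_inj_on_le[of "\<lambda>u. u - w"]) (auto simp: inj_on_def diff \<phi>_diff w)
  next
    case True
    thus ?thesis by (metis card.empty le0)
  qed
  hence "(\<Sum>j\<in>(Fp :: 'a set). card {u\<in>D. \<phi> u = j}) \<le> (\<Sum>j\<in>(Fp :: 'a set). card {u\<in>D. \<phi> u = 0})"
    by (intro sum_mono)
  moreover have "(\<Sum>j\<in>(Fp :: 'a set). \<Sum>u\<in>{u. u \<in> D \<and> \<phi> u = j}. 1) = (\<Sum>u\<in>D. 1 :: nat)"
    by (rule sum.group) (use \<phi>_Fp in auto)
  ultimately show ?thesis by (simp add: card_Fp)
qed

end

section \<open>The sphere-packing bound\<close>

text \<open>The redundancy is e + 2, and in a ball of radius 2 the words of weight exactly 2 already
  outnumber p^(e + 2) = q * p^2.\<close>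

lemma not_sphere_packing_admits:
  fixes p e :: nat
  assumes p: "p \<ge> 3" and e: "e \<ge> 2" and d: "(d - 1) div 2 = 2"
  shows "\<not> sphere_packing_admits p (p ^ e) (p ^ e - e - 2) d"
proof -
  define q where "q = p ^ e"
  have "p ^ 2 \<le> q" using p e by (simp add: q_def power_increasing)
  moreover have "3 * 3 \<le> p ^ 2" using p unfolding power2_eq_square by (intro mult_mono) auto
  ultimately have q9: "q \<ge> 9" by simp
  have "n + 2 \<le> 3 ^ n" if "n \<ge> 2" for n :: nat
    using that by (induction n rule: dec_induct) auto
  also have "3 ^ e \<le> q" using p by (simp add: q_def power_mono)
  finally have eq: "e + 2 \<le> q" using e by simp
  \<comment> \<open>From p < 2(p - 1) follows 2p^2 < 8(p - 1)^2, and 8 is at most q - 1 because q is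
    at least 9.\<close>
  have "2 * p < 2 * (2 * (p - 1))" using p by simp
  hence "p ^ 2 < (2 * (p - 1)) ^ 2" by (intro power_strict_mono) auto
  hence "2 * p ^ 2 < 8 * (p - 1) ^ 2" by (simp add: power_mult_distrib)
  also have "\<dots> \<le> (q - 1) * (p - 1) ^ 2" using q9 by (intro mult_right_mono) auto
  finally have "q * (2 * p ^ 2) < q * ((q - 1) * (p - 1) ^ 2)" using q9 by simp
  also have "\<dots> = 2 * ((q choose 2) * (p - 1) ^ 2)"
  proof -
    have "even (q * (q - 1))" by (cases "even q") auto
    thus ?thesis by (simp add: choose_two)
  qed
  finally have "q * p ^ 2 < (q choose 2) * (p - 1) ^ 2" by simp
  also have "\<dots> \<le> (\<Sum>i\<le>2. (q choose i) * (p - 1) ^ i)"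
    by (simp add: numeral_2_eq_2)
  finally have "p ^ (q - e - 2) * (q * p ^ 2) < p ^ (q - e - 2) * (\<Sum>i\<le>2. (q choose i) * (p - 1) ^ i)"
    using p by simp
  moreover have "p ^ (q - e - 2) * (q * p ^ 2) = p ^ q"
  proof -
    have "p ^ (q - e - 2) * (q * p ^ 2) = p ^ (q - e - 2 + (e + 2))"
      by (simp add: q_def power_add power2_eq_square)
    also have "q - e - 2 + (e + 2) = q" using eq by simp
    finally show ?thesis .
  qed
  ultimately show ?thesis unfolding sphere_packing_admits_def d q_def[symmetric] by linarith
qed

context bent_function
begin

section \<open>Frequencies of the weights\<close>

text \<open>For fixed a and b the map from c to t = -c/a - fs(-b/a) permutes the prime field, so
  each t occurs once for every pair (a, b).\<close>

lemma card_params_dev: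
  "card {(a, b, c). (a, b, c) \<in> params \<and> a \<noteq> 0 \<and> P (dev (- c / a - fs (- b / a)))}
    = (p - 1) * p ^ e * card {t\<in>Fp. P (dev t)}"
proof -
  have "bij_betw (\<lambda>(a, b, c). (a, b, - c / a - fs (- b / a)))
      {(a, b, c). (a, b, c) \<in> params \<and> a \<noteq> 0 \<and> P (dev (- c / a - fs (- b / a)))}
      ((Fp - {0}) \<times> UNIV \<times> {t\<in>Fp. P (dev t)})"
    by (rule bij_betw_byWitness[where f' = "\<lambda>(a, b, t). (a, b, - a * (t + fs (- b / a)))"])
       (auto simp: params_def intro!: Fp_diff Fp_divide Fp_mult Fp_add)
  thus ?thesis
    by (simp add: bij_betw_same_card card_cartesian_product card_Fp card_UNIV)
qed

lemma freq_eq: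
  "freq C (of_int w) = (if w = 0 then 1 else 0) + (if w = int p ^ e then p - 1 else 0)
    + (if w = int p ^ e - int p ^ (e - 1) then p * (p ^ e - 1) else 0)
    + (p - 1) * p ^ e * card {t\<in>Fp. int p ^ e - int p ^ (e - 1) - dev t = w}"
proof -
  define X where "X = {x \<in> params. int (wt ((\<lambda>(a, b, c). word a b c) x)) = w}"
  have "(complex_of_nat n = of_int w) \<longleftrightarrow> int n = w" for n
    by (metis of_int_eq_iff of_int_of_nat_eq)
  hence "{c \<in> C. complex_of_nat (wt c) = of_int w} = {c \<in> C. int (wt c) = w}" by simp
  also have "{c \<in> F ` params. int (wt c) = w} = F ` {x\<in>params. int (wt (F x)) = w}" for F :: "_ \<Rightarrow> 'a \<Rightarrow> 'a"
    by auto
  note this[of "\<lambda>(a, b, c). word a b c", folded code_Cf_eq X_def]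
  finally have "{c \<in> C. complex_of_nat (wt c) = of_int w} = (\<lambda>(a, b, c). word a b c) ` X" .
  hence freq: "freq C (of_int w) = card X"
    using inj_on_subset[OF inj_on_word, of X] by (simp add: freq_def card_image X_def)
  \<comment> \<open>Zero word, nonzero constants, trace words with b nonzero, and words with a
    nonzero. Each of the first three kinds has a single weight, so it contributes entirely or not at
    all.\<close>
  define X1 X2 X3 X4 where
    "X1 = (if w = 0 then {(0, 0, 0)} else {} :: ('a \<times> 'a \<times> 'a) set)" and
    "X2 = (if w = int p ^ e then {0} \<times> {0} \<times> (Fp - {0}) else {} :: ('a \<times> 'a \<times> 'a) set)" and
    "X3 = (if w = int p ^ e - int p ^ (e - 1) then {0} \<times> (UNIV - {0}) \<times> Fp else {} :: ('a \<times> 'a \<times> 'a) set)" and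
    "X4 = {(a, b, c). (a, b, c) \<in> params \<and> a \<noteq> 0 \<and>
        int p ^ e - int p ^ (e - 1) - dev (- c / a - fs (- b / a)) = w}"
  have mem: "(a, b, c) \<in> X \<longleftrightarrow> (a, b, c) \<in> X1 \<union> X2 \<union> X3 \<union> X4" for a b c
  proof (cases "a \<in> Fp \<and> c \<in> Fp")
    case True
    consider "a \<noteq> 0" | "a = 0" "b \<noteq> 0" | "a = 0" "b = 0" "c \<noteq> 0" | "a = 0" "b = 0" "c = 0" by blast
    thus ?thesis
    proof cases
      case 1
      thus ?thesis using True wt_word[of a c b]
        by (simp add: X_def X1_def X2_def X3_def X4_def params_def)
    next
      case 2
      thus ?thesis using True wt_trace_word[of b c]
        by (auto simp: X_def X1_def X2_def X3_def X4_def params_def)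
    next
      case 3
      thus ?thesis using True wt_const_word[of c]
        by (auto simp: X_def X1_def X2_def X3_def X4_def params_def)
    next
      case 4
      thus ?thesis by (auto simp: X_def X1_def X2_def X3_def X4_def params_def)
    qed
  next
    case False
    thus ?thesis by (auto simp: X_def X1_def X2_def X3_def X4_def params_def)
  qed
  have X: "X = X1 \<union> (X2 \<union> (X3 \<union> X4))" using mem by auto
  have "card X = card X1 + (card X2 + (card X3 + card X4))"
    unfolding X
    by (subst card_Un_disjoint, simp, simp, force simp: X1_def X2_def X3_def X4_def)+ simp
  moreover have "card X4 = (p - 1) * p ^ e * card {t\<in>Fp. int p ^ e - int p ^ (e - 1) - dev t = w}"
    unfolding X4_def by (rule card_params_dev)
  ultimately show ?thesis
    by (simp add: freq X1_def X2_def X3_def card_cartesian_product card_Fp card_UNIV)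
qed

section \<open>Self-orthogonality\<close>

lemma p_dvd_card_zeros:
  assumes "e \<ge> 3" "a \<in> Fp" "c \<in> Fp"
  shows "p dvd card {x. word a b c x = 0}"
proof -
  have P: "int p dvd int p ^ (e - 1)" "p dvd p ^ (e - 1)" "p dvd p ^ e"
    using e_ge_2 by (auto intro: dvd_power)
  consider "a \<noteq> 0" | "a = 0" "b \<noteq> 0" | "a = 0" "b = 0" "c \<noteq> 0" | "a = 0" "b = 0" "c = 0" by blast
  thus ?thesis
  proof cases
    case 1
    have "- c / a - fs (- b / a) \<in> Fp" using assms by (intro Fp_diff Fp_divide) auto
    hence "int p dvd int (card {x. word a b c x = 0})"
      using card_zeros_word[of a c b] assms 1 P p_dvd_dev by auto
    thus ?thesis by simp
  next
    case 2
    thus ?thesis using card_zeros_trace_word[of b c] assms P by simp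
  next
    case 3
    thus ?thesis by (simp add: word_def)
  next
    case 4
    thus ?thesis using P by (simp add: card_UNIV)
  qed
qed

text \<open>Grouped by the value j of the word, the coordinates form the zero set of the word with
  constant c - j. Its size is a multiple of p, so each group contributes zero in characteristic
  p.\<close>

lemma sum_word_square:
  assumes "e \<ge> 3" "a \<in> Fp" "c \<in> Fp"
  shows "(\<Sum>x\<in>UNIV. word a b c x * word a b c x) = 0"
proof -
  have "(\<Sum>x\<in>UNIV. word a b c x * word a b c x)
      = (\<Sum>j\<in>Fp. \<Sum>x\<in>{x. x \<in> UNIV \<and> word a b c x = j}. word a b c x * word a b c x)"
    by (rule sum.group[symmetric]) (use assms in auto)
  also have "\<dots> = (\<Sum>j\<in>Fp. of_nat (card {x. word a b (c - j) x = 0}) * (j * j))"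
  proof (intro sum.cong refl)
    fix j :: 'a
    have "{x. x \<in> UNIV \<and> word a b c x = j} = {x. word a b (c - j) x = 0}"
      by (simp add: word_def algebra_simps)
    moreover have "(\<Sum>x\<in>{x. x \<in> UNIV \<and> word a b c x = j}. word a b c x * word a b c x)
        = (\<Sum>x\<in>{x. x \<in> UNIV \<and> word a b c x = j}. j * j)"
      by (intro sum.cong) auto
    ultimately show "(\<Sum>x\<in>{x. x \<in> UNIV \<and> word a b c x = j}. word a b c x * word a b c x)
        = of_nat (card {x. word a b (c - j) x = 0}) * (j * j)" by simp
  qed
  also have "\<dots> = 0"
  proof (intro sum.neutral ballI)
    fix j :: 'a assume "j \<in> Fp"
    hence "p dvd card {x. word a b (c - j) x = 0}" using assms by (intro p_dvd_card_zeros Fp_diff)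
    hence "(of_nat (card {x. word a b (c - j) x = 0}) :: 'a) = 0"
      by (simp add: of_nat_eq_0_iff_char_dvd CHAR_eq)
    thus "of_nat (card {x. word a b (c - j) x = 0}) * (j * j) = 0" by simp
  qed
  finally show ?thesis .
qed

lemma self_orthogonal_C:
  assumes "e \<ge> 3"
  shows "self_orthogonal C"
  unfolding self_orthogonal_def
proof
  fix u assume u: "u \<in> C"
  have "(\<Sum>x\<in>UNIV. u x * v x) = 0" if v: "v \<in> C" for v
  proof -
    have sq: "(\<Sum>x\<in>UNIV. c x * c x) = 0" if "c \<in> C" for c
      using that sum_word_square[OF assms] by (metis code_CfE)
    \<comment> \<open>Polarisation: square sums vanish on the whole code, and 2 is
      invertible.\<close>
    have "(\<Sum>x\<in>UNIV. (u x + v x) * (u x + v x)) = 0"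
      using sq[OF linear_code_add[OF linear_code_C u v]] .
    also have "(\<Sum>x\<in>UNIV. (u x + v x) * (u x + v x))
        = (\<Sum>x\<in>UNIV. u x * u x) + 2 * (\<Sum>x\<in>UNIV. u x * v x) + (\<Sum>x\<in>UNIV. v x * v x)"
      by (simp add: algebra_simps sum.distrib sum_distrib_left)
    finally show ?thesis using sq[OF u] sq[OF v] by simp
  qed
  thus "u \<in> dual_code C"
    using u linear_code_C by (auto simp: dual_code_def linear_code_def)
qed

section \<open>Dual words of weight at most 4\<close>

text \<open>By nondegeneracy of the trace form, orthogonality to the trace words for all b amounts
  to one equation in the large field. The other two equations come from the constant 1 and from
  f.\<close>

lemma dual_code_iff:
  "v \<in> dual_code C \<longleftrightarrow> v \<in> ambient \<and> (\<Sum>x\<in>UNIV. v x) = 0 \<and> (\<Sum>x\<in>UNIV. v x * x) = 0 \<and>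
     (\<Sum>x\<in>UNIV. v x * f x) = 0"
proof (cases "v \<in> ambient")
  case True
  have Tr_sum: "Tr (\<Sum>x\<in>A. g x) = (\<Sum>x\<in>A. Tr (g x))" for g and A :: "'a set"
    by (induction A rule: infinite_finite_induct) (simp_all add: tr_add)
  have eq: "(\<Sum>x\<in>UNIV. v x * word a b c x)
      = a * (\<Sum>x\<in>UNIV. v x * f x) + Tr (b * (\<Sum>x\<in>UNIV. v x * x)) + c * (\<Sum>x\<in>UNIV. v x)" for a b c
  proof -
    have "v x * Tr (b * x) = Tr (b * (v x * x))" for x
      using tr_scale[of "v x" "b * x"] True by (simp add: ambient_def mult_ac)
    thus ?thesis
      by (simp add: word_def distrib_left sum.distrib sum_distrib_left Tr_sum mult_ac)
  qed
  show ?thesis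
  proof
    assume "v \<in> dual_code C"
    hence 0: "(\<Sum>x\<in>UNIV. v x * word a b c x) = 0" if "a \<in> Fp" "c \<in> Fp" for a b c
      using that word_in_code by (auto simp: dual_code_def)
    have "(\<Sum>x\<in>UNIV. v x * x) = 0"
    proof (rule ccontr)
      assume "(\<Sum>x\<in>UNIV. v x * x) \<noteq> 0"
      then obtain b where "Tr (b * (\<Sum>x\<in>UNIV. v x * x)) = 1" using tr_surj_mult[of _ 1] by auto
      thus False using 0[of 0 0 b] eq[of 0 b 0] by simp
    qed
    thus "v \<in> ambient \<and> (\<Sum>x\<in>UNIV. v x) = 0 \<and> (\<Sum>x\<in>UNIV. v x * x) = 0 \<and> (\<Sum>x\<in>UNIV. v x * f x) = 0"
      using True 0[of 1 0 0] 0[of 0 1 0] eq[of 1 0 0] eq[of 0 0 1] by simp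
  next
    assume "v \<in> ambient \<and> (\<Sum>x\<in>UNIV. v x) = 0 \<and> (\<Sum>x\<in>UNIV. v x * x) = 0 \<and> (\<Sum>x\<in>UNIV. v x * f x) = 0"
    thus "v \<in> dual_code C" unfolding dual_code_def by (auto elim!: code_CfE simp: eq)
  qed
qed (auto simp: dual_code_def)

lemma sum_support: fixes v :: "'a \<Rightarrow> 'a" shows "(\<Sum>x\<in>UNIV. v x * g x) = (\<Sum>x\<in>{x. v x \<noteq> 0}. v x * g x :: 'a)"
  by (rule sum.mono_neutral_right) auto

lemma wt_dual_ge_3:
  assumes v: "v \<in> dual_code C" "v \<noteq> (\<lambda>x. 0)"
  shows "wt v \<ge> 3"
proof (rule ccontr)
  assume "\<not> wt v \<ge> 3"
  hence "card {x. v x \<noteq> 0} = 0 \<or> card {x. v x \<noteq> 0} = 1 \<or> card {x. v x \<noteq> 0} = 2"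
    unfolding wt_def by linarith
  moreover have s: "(\<Sum>x\<in>{x. v x \<noteq> 0}. v x) = 0" "(\<Sum>x\<in>{x. v x \<noteq> 0}. v x * x) = 0"
    using v sum_support[of v "\<lambda>x. 1"] sum_support[of v "\<lambda>x. x"] by (simp_all add: dual_code_iff)
  moreover have "card {x. v x \<noteq> 0} \<noteq> 0" using v(2) by (auto simp: fun_eq_iff)
  ultimately consider (1) x where "{x. v x \<noteq> 0} = {x}" | (2) x y where "{x. v x \<noteq> 0} = {x, y}" "x \<noteq> y"
    by (auto simp: card_1_singleton_iff card_2_iff)
  thus False
  proof cases
    case 1
    thus False using s(1) by auto
  next
    case (2 x y)
    have "v x + v y = 0" "v x * x + v y * y = 0" using s 2 by auto
    moreover from this(1) have "v y = - v x" by (simp add: add_eq_0_iff)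
    ultimately have "v x * (x - y) = 0" by (simp add: algebra_simps)
    thus False using 2 by auto
  qed
qed

text \<open>In geometric terms, the support of a dual word of weight 3 gives three collinear points:
  every plane through two of them contains the third.\<close>

lemma zero_on_third:
  assumes v: "v \<in> dual_code C" and supp: "{x. v x \<noteq> 0} = {x1, x2, x3}" "x1 \<noteq> x3" "x2 \<noteq> x3"
    and w: "w \<in> C" "w x1 = 0" "w x2 = 0"
  shows "w x3 = 0"
proof -
  have "(\<Sum>x\<in>{x1, x2, x3}. v x * w x) = 0"
    using v w(1) sum_support[of v w] supp by (simp add: dual_code_def)
  also have "(\<Sum>x\<in>{x1, x2, x3}. v x * w x) = (\<Sum>x\<in>{x3}. v x * w x)"
    using w supp by (intro sum.mono_neutral_right) auto
  finally show ?thesis using supp by auto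
qed

text \<open>The points (1, x, f x), together with one point at infinity, meet every plane of projective 3-space in
  1 or p + 1 points. If three of them were collinear, counting the incidences between the points and
  the planes through that line would give a contradiction.\<close>
lemma wt_dual_neq_3:
  assumes e2: "e = 2" and dev: "\<And>t. t \<in> Fp \<Longrightarrow> dev t \<le> 1" and v: "v \<in> dual_code C"
  shows "wt v \<noteq> 3"
proof
  assume "wt v = 3"
  then obtain x1 x2 x3 where supp: "{x. v x \<noteq> 0} = {x1, x2, x3}" and
      ne: "x1 \<noteq> x2" "x1 \<noteq> x3" "x2 \<noteq> x3"
    unfolding wt_def card_3_iff by blast
  \<comment> \<open>The constant is chosen so that the word vanishes at \<open>x1\<close>; vanishing
    at \<open>x2\<close> as well then defines \<open>D\<close>. Thus \<open>D\<close> consists of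
    the planes through the supposed line, counted with scalar multiples and together with the zero
    word.\<close>
  define w where "w = (\<lambda>(a, b). word a b (- a * f x1 - Tr (b * x1)))"
  have w_eq: "w d x = fst d * (f x - f x1) + Tr (snd d * (x - x1))" for d x
    by (cases d) (simp add: w_def word_def algebra_simps tr_diff)
  define D where "D = (SIGMA a:Fp. {b. Tr (b * (x2 - x1)) = - a * (f x2 - f x1)})"
  have k: "- a * (f x2 - f x1) \<in> Fp" if "a \<in> Fp" for a
    using that by (intro Fp_mult Fp_diff) auto
  have pe: "p ^ (e - 1) = p" "int p ^ (e - 1) = int p" using e2 by simp_all
  have cardTr: "card {b. Tr (b * (x2 - x1)) = j} = p" if "j \<in> Fp" for j
    using card_tr_fibre[of "x2 - x1" j] ne that pe by simp
  have D: "d \<in> D \<longleftrightarrow> fst d \<in> Fp \<and> w d x2 = 0" for d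
    by (cases d) (auto simp: D_def w_eq eq_neg_iff_add_eq_0 add.commute)
  have card_D: "card D = p * p"
    unfolding D_def using cardTr k by (simp add: card_Fp)
  have card_D0: "card {d\<in>D. fst d = 0} = p"
  proof -
    have "{d\<in>D. fst d = 0} = {0} \<times> {b. Tr (b * (x2 - x1)) = 0}" by (auto simp: D_def)
    thus ?thesis using cardTr[of 0] by (simp add: card_cartesian_product)
  qed
  have w_code: "w d \<in> C" if "d \<in> D" for d
    using that unfolding D_def w_def by (auto intro!: word_in_code Fp_diff Fp_mult)
  have w0: "w d x = 0" if "d \<in> D" "x \<in> {x1, x2, x3}" for d x
  proof -
    have "w d x1 = 0" "w d x2 = 0" using that D by (auto simp: w_eq)
    moreover have "w d x3 = 0"
      using zero_on_third[OF v supp ne(2,3) w_code[OF that(1)]] calculation by blast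
    ultimately show ?thesis using that(2) by blast
  qed
  \<comment> \<open>The three bounds p + 1, p and p * p, for a nonzero, for a zero with b nonzero,
    and for the zero word, are merged into one expression that sums easily.\<close>
  have upper: "int (card {x. w d x = 0})
      \<le> (int p + 1) - (if fst d = 0 then 1 else 0) + (if d = 0 then int p * int p - int p else 0)"
    if d: "d \<in> D" for d
  proof -
    obtain a b where ab: "d = (a, b)" by fastforce
    define c where "c = - a * f x1 - Tr (b * x1)"
    have a: "a \<in> Fp" using d ab by (auto simp: D_def)
    hence c: "c \<in> Fp" unfolding c_def by (auto intro!: Fp_diff Fp_mult)
    have wd: "w d = word a b c" by (simp add: w_def ab c_def)
    consider "a \<noteq> 0" | "a = 0" "b \<noteq> 0" | "a = 0" "b = 0" by blast
    thus ?thesis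
    proof cases
      case 1
      have "- c / a - fs (- b / a) \<in> Fp" using a c by (intro Fp_diff Fp_divide) auto
      hence "int (card {x. w d x = 0}) \<le> int p + 1"
        using card_zeros_word[OF a 1 c, of b] dev by (simp only: wd pe) simp
      thus ?thesis using 1 by (simp add: ab zero_prod_def)
    next
      case 2
      hence "card {x. w d x = 0} = p"
        using card_zeros_trace_word[of b c] c by (simp add: wd pe del: One_nat_def)
      thus ?thesis using 2 by (simp add: ab zero_prod_def)
    next
      case 3
      have "card {x. w d x = 0} \<le> card (UNIV :: 'a set)" by (intro card_mono) auto
      hence "int (card {x. w d x = 0}) \<le> int p * int p"
        using e2 by (simp add: card_UNIV power2_eq_square flip: of_nat_mult)
      thus ?thesis using 3 by (simp add: ab zero_prod_def)
    qed
  qed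
  have zeroD: "0 \<in> D" by (auto simp: D_def zero_prod_def)
  have "(\<Sum>d\<in>D. int (card {x. w d x = 0}))
      \<le> (\<Sum>d\<in>D. (int p + 1) - (if fst d = 0 then 1 else 0) + (if d = 0 then int p * int p - int p else 0))"
    by (intro sum_mono upper)
  also have "\<dots> = int (card D) * (int p + 1) - int (card {d\<in>D. fst d = 0}) + (int p * int p - int p)"
    using zeroD by (simp add: sum.distrib sum_subtractf sum.If_cases Int_def)
  finally have up: "(\<Sum>d\<in>D. int (card {x. w d x = 0}))
      \<le> int p * int p * (int p + 1) - int p + (int p * int p - int p)"
    by (simp add: card_D card_D0)
  \<comment> \<open>Vanishing at one more point is a single linear condition on the p * p elements
    of \<open>D\<close>, so at least p satisfy it; at the three collinear points all of them
    do.\<close>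
  have lower: "int p + (if x \<in> {x1, x2, x3} then int p * int p - int p else 0) \<le> int (card {d\<in>D. w d x = 0})" for x
  proof (cases "x \<in> {x1, x2, x3}")
    case True
    hence "{d\<in>D. w d x = 0} = D" using w0 by auto
    thus ?thesis using True by (simp add: card_D)
  next
    case False
    have "card D \<le> p * card {d\<in>D. w d x = 0}"
    proof (rule card_le_card_kernel)
      fix d d' assume dd: "d \<in> D" "d' \<in> D"
      have lin: "w (d - d') y = w d y - w d' y" for y
        by (simp add: w_eq algebra_simps tr_diff tr_add)
      show "w (d - d') x = w d x - w d' x" by (rule lin)
      show "d - d' \<in> D" using dd by (simp add: D lin Fp_diff)
    next
      fix d assume "d \<in> D"
      thus "w d x \<in> Fp" using linear_code_Fp[OF linear_code_C w_code] by blast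
    qed
    hence "p \<le> card {d\<in>D. w d x = 0}" using p_ge_3 by (simp add: card_D)
    thus ?thesis using False by simp
  qed
  have "int p * int p * int p + 3 * (int p * int p - int p)
      = (\<Sum>x\<in>UNIV. int p + (if x \<in> {x1, x2, x3} then int p * int p - int p else 0))"
  proof -
    have "card {x1, x2, x3} = 3" using ne by simp
    moreover have "UNIV \<inter> {x. x \<in> {x1, x2, x3}} = {x1, x2, x3}" by auto
    ultimately show ?thesis
      by (simp only: sum.distrib sum.If_cases finite sum_constant card_UNIV e2) (simp add: power2_eq_square)
  qed
  also have "\<dots> \<le> (\<Sum>x\<in>UNIV. int (card {d\<in>D. w d x = 0}))"
    by (intro sum_mono lower)
  also have "\<dots> = (\<Sum>x\<in>UNIV. \<Sum>d\<in>D. if w d x = 0 then 1 else 0)"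
    by (simp add: sum.If_cases Int_def)
  also have "\<dots> = (\<Sum>d\<in>D. \<Sum>x\<in>UNIV. if w d x = 0 then 1 else 0)"
    by (rule sum.swap)
  also have "\<dots> = (\<Sum>d\<in>D. int (card {x. w d x = 0}))"
    by (simp add: sum.If_cases)
  \<comment> \<open>With two points in place of three the bounds would balance exactly; the third
    leaves a surplus of p * p - p.\<close>
  finally have "int p * int p \<le> int p" using up by (simp add: algebra_simps)
  moreover have "int p * 1 < int p * int p" using p_ge_3 by (intro mult_strict_left_mono) auto
  ultimately show False by simp
qed

lemma ex_dual_wt_3:
  assumes x: "x \<noteq> 0" "f x = 0" "f (- x) = 0" and f0: "f 0 = 0"
  shows "\<exists>v\<in>dual_code C. wt v = 3"
proof -
  define v :: "'a \<Rightarrow> 'a" where "v = (\<lambda>z. if z = 0 then -2 else if z = x \<or> z = - x then 1 else 0)"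
  have xx: "x \<noteq> - x" by (rule neq_uminus) fact
  have supp: "{z. v z \<noteq> 0} = {0, x, - x}" by (auto simp: v_def)
  have two: "(2 :: 'a) \<in> Fp" using Fp_of_int[of 2] by simp
  have s: "(\<Sum>z\<in>UNIV. v z * g z) = g x + g (- x) - 2 * g 0" for g
    using x(1) xx by (simp add: sum_support[of v] supp) (auto simp: v_def)
  have "v \<in> dual_code C"
    unfolding dual_code_iff using s[of "\<lambda>_. 1"] s[of "\<lambda>z. z"] s[of f] x f0 two
    by (simp add: ambient_def v_def)
  moreover have "wt v = 3" unfolding wt_def supp using x(1) xx by simp
  ultimately show ?thesis by blast
qed

text \<open>Equal coefficients at opposite points cancel the linear condition; opposite signs on the
  two pairs cancel the constant one and, as f agrees on all four points, that of f.\<close>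

lemma ex_dual_wt_4:
  assumes x: "x \<noteq> 0" "y \<noteq> 0" "y \<noteq> x" "y \<noteq> - x" and f: "f (- x) = f x" "f (- y) = f y" "f y = f x"
  shows "\<exists>v\<in>dual_code C. wt v = 4"
proof -
  define v :: "'a \<Rightarrow> 'a" where
    "v = (\<lambda>z. if z = x \<or> z = - x then 1 else if z = y \<or> z = - y then -1 else 0)"
  have ne: "x \<noteq> - x" "y \<noteq> - y" "x \<noteq> - y" using neq_uminus x by auto
  have supp: "{z. v z \<noteq> 0} = {x, - x, y, - y}" by (auto simp: v_def)
  have s: "(\<Sum>z\<in>UNIV. v z * g z) = g x + g (- x) - g y - g (- y)" for g
    using x ne by (simp add: sum_support[of v] supp) (auto simp: v_def)
  have "v \<in> dual_code C"
    unfolding dual_code_iff using s[of "\<lambda>_. 1"] s[of "\<lambda>z. z"] s[of f] f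
    by (simp add: ambient_def v_def)
  moreover have "wt v = 4" unfolding wt_def supp using x ne by auto
  ultimately show ?thesis by blast
qed

subsection \<open>Weight distribution and minimum distance of the dual code\<close>

lemma p_power_pos: "int p ^ (e - 1) > 0"
  using p_ge_3 by simp

lemma freq_0: "freq C 0 = 1"
proof -
  have "{t\<in>Fp. int p ^ e - int p ^ (e - 1) - dev t = 0} = {}"
    using abs_dev_less p_power_e_gt by fastforce
  moreover have "0 \<noteq> int p ^ e" "0 \<noteq> int p ^ e - int p ^ (e - 1)"
    using p_power_e_gt p_power_pos by linarith+
  ultimately show ?thesis using freq_eq[of 0] by simp
qed

lemma freq_full: "freq C (of_nat (p ^ e)) = p - 1"
proof -
  have "{t\<in>Fp. int p ^ e - int p ^ (e - 1) - dev t = int p ^ e} = {}"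
    using abs_dev_less by fastforce
  moreover have "int p ^ e \<noteq> 0" "int p ^ e \<noteq> int p ^ e - int p ^ (e - 1)"
    using p_ge_3 by simp_all
  ultimately show ?thesis using freq_eq[of "int p ^ e"] by simp
qed

lemma freq_middle:
  "freq C (of_nat (p ^ e) - of_nat (p ^ (e - 1))) = p * (p ^ e - 1) + (p - 1) * p ^ e * card {t\<in>Fp. dev t = 0}"
proof -
  have "int p ^ e - int p ^ (e - 1) \<noteq> 0" "int p ^ e - int p ^ (e - 1) \<noteq> int p ^ e"
    using p_power_e_gt p_power_pos by linarith+
  thus ?thesis using freq_eq[of "int p ^ e - int p ^ (e - 1)"] by simp
qed

lemma freq_dev:
  assumes "d \<noteq> 0" "\<bar>d\<bar> < int p ^ (e - 1)"
  shows "freq C (of_nat (p ^ e) - of_nat (p ^ (e - 1)) - of_int d) = (p - 1) * p ^ e * card {t\<in>Fp. dev t = d}"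
proof -
  have "int p ^ e - int p ^ (e - 1) - d \<noteq> 0" "int p ^ e - int p ^ (e - 1) - d \<noteq> int p ^ e"
      "int p ^ e - int p ^ (e - 1) - d \<noteq> int p ^ e - int p ^ (e - 1)"
    using p_power_e_gt assms by linarith+
  thus ?thesis using freq_eq[of "int p ^ e - int p ^ (e - 1) - d"] by simp
qed

lemma wt_cases:
  assumes "v \<in> C"
  obtains "wt v = 0" | "wt v = p ^ e" | "complex_of_nat (wt v) = of_nat (p ^ e) - of_nat (p ^ (e - 1))"
    | t where "t \<in> Fp" "complex_of_nat (wt v) = of_nat (p ^ e) - of_nat (p ^ (e - 1)) - of_int (dev t)"
proof -
  obtain a b c where v: "a \<in> Fp" "c \<in> Fp" "v = word a b c" using assms by (rule code_CfE)
  have C: "complex_of_nat (wt v) = of_int (int (wt v))" by simp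
  consider "a \<noteq> 0" | "a = 0" "b \<noteq> 0" | "a = 0" "b = 0" "c \<noteq> 0" | "a = 0" "b = 0" "c = 0" by blast
  thus ?thesis
  proof cases
    case 1
    have "- c / a - fs (- b / a) \<in> Fp" using v by (intro Fp_diff Fp_divide) auto
    moreover have "complex_of_nat (wt v)
        = of_nat (p ^ e) - of_nat (p ^ (e - 1)) - of_int (dev (- c / a - fs (- b / a)))"
      unfolding C using wt_word[OF v(1) 1 v(2), of b] by (simp only: v(3)) simp
    ultimately show ?thesis using that(4) by blast
  next
    case 2
    have "complex_of_nat (wt v) = of_nat (p ^ e) - of_nat (p ^ (e - 1))"
      unfolding C using wt_trace_word[OF 2(2) v(2)] by (simp only: v(3) 2(1)) simp
    thus ?thesis using that(3) by blast
  next
    case 3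
    hence "int (wt v) = int (p ^ e)" using wt_const_word[of c] v by simp
    thus ?thesis using that(2) by (simp only: of_nat_eq_iff)
  next
    case 4
    thus ?thesis using that(1) v by simp
  qed
qed

lemma weight_distribution_even:
  assumes "even e"
  defines "s \<equiv> sqrt_pstar p ^ e"
  shows "\<forall>c\<in>C. complex_of_nat (wt c) \<in>
         {0, of_nat (p ^ e) - of_nat (p ^ (e - 1)) - of_int eps * (of_nat p - 1) * s / of_nat p,
          of_nat (p ^ e) - of_nat (p ^ (e - 1)) + of_int eps * s / of_nat p,
          of_nat (p ^ e) - of_nat (p ^ (e - 1)), of_nat (p ^ e)}" (is ?A)
    and "freq C (of_nat (p ^ e) - of_nat (p ^ (e - 1)) - of_int eps * (of_nat p - 1) * s / of_nat p)
        = (p - 1) * p ^ e" (is ?B)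
    and "freq C (of_nat (p ^ e) - of_nat (p ^ (e - 1)) + of_int eps * s / of_nat p) = (p - 1)^2 * p ^ e" (is ?C)
    and "freq C (of_nat (p ^ e) - of_nat (p ^ (e - 1))) = p * (p ^ e - 1)" (is ?D)
proof -
  obtain T :: int where T: "of_int (int p * T) = sqrt_pstar p ^ e" "\<bar>T\<bar> = int p ^ (e div 2 - 1)"
    "\<And>t. t \<in> Fp \<Longrightarrow> dev t = eps * T * (if t = 0 then int p - 1 else -1)"
    using dev_even[OF assms(1)] by metis
  have p0: "(of_nat p :: complex) \<noteq> 0" using p_ge_3 by simp
  have s: "s = of_nat p * of_int T" using T(1) by (simp add: s_def)
  \<comment> \<open>The complex weight expressions become integer deviations, to which
    \<open>freq_dev\<close> applies.\<close>
  have W1: "of_int eps * (of_nat p - 1) * s / of_nat p = of_int (eps * T * (int p - 1))"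
    and W2: "of_nat (p ^ e) - of_nat (p ^ (e - 1)) + of_int eps * s / of_nat p
      = of_nat (p ^ e) - of_nat (p ^ (e - 1)) - complex_of_int (eps * T * -1)"
    using p0 by (simp_all add: s)
  have "\<bar>T\<bar> > 0" unfolding T(2) using p_ge_3 by simp
  hence eT: "eps * T \<noteq> 0" using eps by auto
  have d0: "dev 0 = eps * T * (int p - 1)" and d1: "dev 1 = eps * T * -1" using T(3)[of 0] T(3)[of 1] by auto
  have ne: "eps * T * (int p - 1) \<noteq> 0" "eps * T * -1 \<noteq> 0" "eps * T * (int p - 1) \<noteq> eps * T * -1"
  proof -
    show "eps * T * (int p - 1) \<noteq> 0" "eps * T * -1 \<noteq> 0" using eT p_ge_3 by simp_all
    show "eps * T * (int p - 1) \<noteq> eps * T * -1" using eT p_ge_3 by (subst mult_cancel_left) simp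
  qed
  have sets: "{t\<in>Fp. dev t = eps * T * (int p - 1)} = {0}" "{t\<in>Fp. dev t = eps * T * -1} = Fp - {0}"
      "{t\<in>Fp. dev t = 0} = {}"
    using T(3) ne by (auto split: if_splits)
  show ?B
    unfolding W1 using freq_dev[OF ne(1)] abs_dev_less[of 0] sets(1) by (simp add: d0)
  show ?C
    unfolding W2 using freq_dev[OF ne(2)] abs_dev_less[of 1] sets(2) d1
    by (simp add: card_Fp power2_eq_square)
  show ?D
    using freq_middle sets(3) by simp
  show ?A
  proof
    fix c assume "c \<in> C"
    thus "complex_of_nat (wt c) \<in>
         {0, of_nat (p ^ e) - of_nat (p ^ (e - 1)) - of_int eps * (of_nat p - 1) * s / of_nat p,
          of_nat (p ^ e) - of_nat (p ^ (e - 1)) + of_int eps * s / of_nat p,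
          of_nat (p ^ e) - of_nat (p ^ (e - 1)), of_nat (p ^ e)}"
      unfolding W1 W2 by (cases rule: wt_cases) (simp_all add: T(3))
  qed
qed

lemma weight_distribution_odd:
  assumes "odd e"
  defines "s \<equiv> sqrt_pstar p ^ e"
  shows "\<forall>c\<in>C. complex_of_nat (wt c) \<in>
         {0, of_nat (p ^ e) - of_nat (p ^ (e - 1)) - of_int eps * s * G / of_nat p,
          of_nat (p ^ e) - of_nat (p ^ (e - 1)) + of_int eps * s * G / of_nat p,
          of_nat (p ^ e) - of_nat (p ^ (e - 1)), of_nat (p ^ e)}" (is ?A)
    and "freq C (of_nat (p ^ e) - of_nat (p ^ (e - 1)) - of_int eps * s * G / of_nat p)
        = (p - 1)^2 * p ^ e div 2" (is ?B)
    and "freq C (of_nat (p ^ e) - of_nat (p ^ (e - 1)) + of_int eps * s * G / of_nat p)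
        = (p - 1)^2 * p ^ e div 2" (is ?C)
    and "freq C (of_nat (p ^ e) - of_nat (p ^ (e - 1))) = 2 * p ^ (e + 1) - p ^ e - p" (is ?D)
proof -
  obtain T \<sigma> :: int where T: "of_int (int p * T) = sqrt_pstar p ^ e * G" "\<bar>T\<bar> = int p ^ (e div 2)"
    "\<sigma> = 1 \<or> \<sigma> = -1" "\<And>t. t \<in> Fp \<Longrightarrow> dev t = \<sigma> * (eps * T) * quad_char t"
    using dev_odd[OF assms(1)] by metis
  have p0: "(of_nat p :: complex) \<noteq> 0" using p_ge_3 by simp
  have s: "s * G = of_nat p * of_int T" using T(1) by (simp add: s_def)
  have W1: "of_int eps * s * G / of_nat p = complex_of_int (eps * T)"
    using p0 by (simp add: s mult.assoc)
  have W2: "of_nat (p ^ e) - of_nat (p ^ (e - 1)) + complex_of_int (eps * T)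
      = of_nat (p ^ e) - of_nat (p ^ (e - 1)) - complex_of_int (- (eps * T))" by simp
  have "\<bar>T\<bar> > 0" unfolding T(2) using p_ge_3 by simp
  hence eT: "eps * T \<noteq> 0" "- (eps * T) \<noteq> 0" using eps by auto
  have abs: "\<bar>eps * T\<bar> < int p ^ (e - 1)" "\<bar>- (eps * T)\<bar> < int p ^ (e - 1)"
    using abs_dev_less[of 1] T(3) T(4)[of 1] by (auto simp: abs_mult quad_char_def split: if_splits)
  have sets: "{t\<in>Fp. dev t = eps * T} = {t\<in>Fp. quad_char t = \<sigma>}"
      "{t\<in>Fp. dev t = - (eps * T)} = {t\<in>Fp. quad_char t = - \<sigma>}" "{t\<in>Fp. dev t = 0} = {0}"
    using T(3,4) eT quad_char_cases by (auto, force+)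
  have half: "(p - 1) * p ^ e * n = (p - 1)^2 * p ^ e div 2" if "2 * n = p - 1" for n
  proof -
    have "(p - 1)^2 * p ^ e = 2 * ((p - 1) * p ^ e * n)"
      unfolding power2_eq_square by (subst (2) that[symmetric]) simp
    thus ?thesis by (simp only: nonzero_mult_div_cancel_left)
  qed
  show ?B
    unfolding W1 freq_dev[OF eT(1) abs(1)] sets(1) using T(3) by (intro half card_quad_char) auto
  show ?C
    unfolding W1 W2 freq_dev[OF eT(2) abs(2)] sets(2) using T(3) by (intro half card_quad_char) auto
  show ?D
  proof -
    \<comment> \<open>Successor form resolves the truncated subtractions in p(p^e - 1) + (p - 1)p^e
      = 2p^(e + 1) - p^e - p.\<close>
    obtain q' p' where "p ^ e = Suc q'" "p = Suc p'" using p_ge_3 by (metis Suc_pred le_0_eq not_gr0 not_numeral_le_zero zero_less_power)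
    moreover have "p ^ (e + 1) = p * p ^ e" by simp
    ultimately show ?thesis unfolding freq_middle sets(3) by simp
  qed
  show ?A
  proof
    fix c assume "c \<in> C"
    thus "complex_of_nat (wt c) \<in>
         {0, of_nat (p ^ e) - of_nat (p ^ (e - 1)) - of_int eps * s * G / of_nat p,
          of_nat (p ^ e) - of_nat (p ^ (e - 1)) + of_int eps * s * G / of_nat p,
          of_nat (p ^ e) - of_nat (p ^ (e - 1)), of_nat (p ^ e)}"
    proof (cases rule: wt_cases)
      case (4 t)
      thus ?thesis unfolding W1 using T(3) T(4)[of t] quad_char_cases[of t] by auto
    qed simp_all
  qed
qed

text \<open>For e = 2 the squared root is pstar, which is p times the quadratic character of -1;
  hence \<open>T\<close> is that character value.\<close>

lemma dev_e_2:
  assumes "e = 2" "t \<in> Fp"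
  shows "dev t = eps * quad_char (-1 :: 'a) * (if t = 0 then int p - 1 else -1)"
proof -
  have "even e" using assms by simp
  then obtain T :: int where T: "of_int (int p * T) = sqrt_pstar p ^ e"
    "\<And>t. t \<in> Fp \<Longrightarrow> dev t = eps * T * (if t = 0 then int p - 1 else -1)"
    using dev_even by metis
  have "complex_of_int (int p * T) = of_int pstar"
    using T(1) sqrt_pstar_square by (simp only: assms)
  hence "int p * T = int p * quad_char (-1 :: 'a)"
    by (simp only: of_int_eq_iff) (simp add: pstar_def quad_char_minus_1)
  hence "T = quad_char (-1 :: 'a)" using p_ge_3 by (subst (asm) mult_cancel_left) simp
  thus ?thesis using T(2)[OF assms(2)] by simp
qed

text \<open>For e = 2 the deviation is at least -1, leaving at least p - 1 zeros; for larger e the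
  number of zeros is a positive multiple of p. Two zeros guarantee one other than 0.\<close>

lemma card_f_zeros_ge_2:
  assumes "\<not> (e = 2 \<and> eps * quad_char (-1 :: 'a) = -1)"
  shows "card {x. f x = 0} \<ge> 2"
proof -
  have m: "0 - fs 0 \<in> Fp" using fs_Fp by (intro Fp_diff) auto
  have "int (card {x. f x = 0}) = int p ^ (e - 1) + dev (0 - fs 0)"
    using fibre_eq[of 0 0] by (simp add: fibre_def)
  moreover have "int p ^ (e - 1) + dev (0 - fs 0) \<ge> 2"
  proof (cases "e = 2")
    case True
    hence "eps * quad_char (-1 :: 'a) = 1"
      using assms eps by (auto simp: quad_char_minus_1 split: if_splits)
    hence "dev (0 - fs 0) \<ge> -1" using dev_e_2[OF True m] p_ge_3 by simp
    thus ?thesis using p_ge_3 True by simp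
  next
    case False
    hence e3: "e \<ge> 3" using e_ge_2 by simp
    have "int p dvd int p ^ (e - 1)" using e_ge_2 by (intro dvd_power) auto
    hence "int p dvd int p ^ (e - 1) + dev (0 - fs 0)" using p_dvd_dev[OF m e3] by (rule dvd_add)
    moreover have "int p ^ (e - 1) + dev (0 - fs 0) > 0" using abs_dev_less[OF m] by linarith
    ultimately have "int p \<le> int p ^ (e - 1) + dev (0 - fs 0)" by (rule zdvd_imp_le)
    thus ?thesis using p_ge_3 by simp
  qed
  ultimately show ?thesis by simp
qed

lemma min_dist_dual_3:
  assumes "\<not> (e = 2 \<and> eps * quad_char (-1 :: 'a) = -1)" and f: "f 0 = 0" "\<And>x. f (- x) = f x"
  shows "min_dist (dual_code C) = 3"
proof -
  have "\<not> {x. f x = 0} \<subseteq> {0}"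
  proof
    assume "{x. f x = 0} \<subseteq> {0}"
    hence "card {x. f x = 0} \<le> card {0 :: 'a}" by (intro card_mono) auto
    thus False using card_f_zeros_ge_2[OF assms(1)] by simp
  qed
  then obtain x where x: "x \<noteq> 0" "f x = 0" by blast
  then obtain v where v: "v \<in> dual_code C" "wt v = 3"
    using ex_dual_wt_3[of x] f by auto
  moreover have "v \<noteq> (\<lambda>x. 0)" using v(2) by (auto simp: wt_def)
  ultimately show ?thesis using wt_dual_ge_3 by (intro min_dist_eqI[of _ _ v])
qed

lemma min_dist_dual_4:
  assumes e2: "e = 2" and eps1: "eps * quad_char (-1 :: 'a) = -1" and f: "f 0 = 0" "\<And>x. f (- x) = f x"
  shows "min_dist (dual_code C) = 4"
proof -
  have dev: "dev t = (if t = 0 then 1 - int p else 1)" if "t \<in> Fp" for t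
    using dev_e_2[OF e2 that] eps1 by simp
  \<comment> \<open>A value j different from 0 keeps the chosen points away from 0, and j different
    from \<open>fs 0\<close> makes its fibre the large one, of size p + 1. This exceeds the size of
    any pair x, -x.\<close>
  have "\<not> (Fp :: 'a set) \<subseteq> {0, fs 0}"
  proof
    assume "(Fp :: 'a set) \<subseteq> {0, fs 0}"
    hence "card (Fp :: 'a set) \<le> card {0, fs 0}" by (intro card_mono) auto
    also have "\<dots> \<le> 2" by (simp add: card_insert_if)
    finally show False using p_ge_3 card_Fp by simp
  qed
  then obtain j :: 'a where j: "j \<in> Fp" "j \<noteq> 0" "j \<noteq> fs 0" by blast
  have "int (card {x. f x = j}) = int p + 1"
  proof -
    have "dev (j - fs 0) = 1" using dev[of "j - fs 0"] j by (simp add: Fp_diff)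
    moreover have "int p ^ (e - 1) = int p" using e2 by simp
    ultimately show ?thesis using fibre_eq[OF j(1), of 0] by (simp only: fibre_def) simp
  qed
  hence card_j: "card {x. f x = j} \<ge> 3" using p_ge_3 by simp
  hence "{x. f x = j} \<noteq> {}" by (metis card.empty not_numeral_le_zero)
  then obtain x where x: "f x = j" by blast
  have "\<not> {x. f x = j} \<subseteq> {x, - x}"
  proof
    assume "{x. f x = j} \<subseteq> {x, - x}"
    hence "card {x. f x = j} \<le> card {x, - x}" by (intro card_mono) auto
    also have "\<dots> \<le> 2" by (simp add: card_insert_if)
    finally show False using card_j by simp
  qed
  then obtain y where y: "f y = j" "y \<noteq> x" "y \<noteq> - x" by blast
  have "x \<noteq> 0" "y \<noteq> 0" using x y j f(1) by auto
  then obtain v where v: "v \<in> dual_code C" "wt v = 4"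
    using ex_dual_wt_4[of x y] x y f by auto
  have "d \<in> dual_code C \<Longrightarrow> d \<noteq> (\<lambda>x. 0) \<Longrightarrow> 4 \<le> wt d" for d
    using wt_dual_ge_3[of d] wt_dual_neq_3[OF e2, of d] dev p_ge_3 by fastforce
  moreover have "v \<noteq> (\<lambda>x. 0)" using v(2) by (auto simp: wt_def)
  ultimately show ?thesis using v by (intro min_dist_eqI[of _ _ v])
qed

end

theorem theorem4p2:
  fixes f :: "'a::{field,finite} \<Rightarrow> 'a" and p e :: nat and eps :: int
  assumes "prime p" and "odd p" and "e \<ge> 2" and "CARD('a) = p ^ e"
    and "in_RF p e f" and "wrb_with_sign p e f eps"
  defines "C \<equiv> code_Cf p e f"
    and "q \<equiv> p ^ e"
    and "s \<equiv> sqrt_pstar p ^ e"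
    and "G \<equiv> gauss_sum p TYPE('a)"
  shows "(linear_code C \<and> code_dim C = e + 2) \<and>
     (even e \<longrightarrow>
      (\<forall>c\<in>C. complex_of_nat (wt c) \<in>
         {0, of_nat q - of_nat (p ^ (e - 1)) - of_int eps * (of_nat p - 1) * s / of_nat p,
          of_nat q - of_nat (p ^ (e - 1)) + of_int eps * s / of_nat p,
          of_nat q - of_nat (p ^ (e - 1)), of_nat q}) \<and>
      freq C 0 = 1 \<and>
      freq C (of_nat q - of_nat (p ^ (e - 1)) - of_int eps * (of_nat p - 1) * s / of_nat p)
        = (p - 1) * p ^ e \<and>
      freq C (of_nat q - of_nat (p ^ (e - 1)) + of_int eps * s / of_nat p) = (p - 1)^2 * p ^ e \<and>
      freq C (of_nat q - of_nat (p ^ (e - 1))) = p * (p ^ e - 1) \<and>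
      freq C (of_nat q) = p - 1) \<and>
     (odd e \<longrightarrow>
      (\<forall>c\<in>C. complex_of_nat (wt c) \<in>
         {0, of_nat q - of_nat (p ^ (e - 1)) - of_int eps * s * G / of_nat p,
          of_nat q - of_nat (p ^ (e - 1)) + of_int eps * s * G / of_nat p,
          of_nat q - of_nat (p ^ (e - 1)), of_nat q}) \<and>
      freq C 0 = 1 \<and>
      freq C (of_nat q - of_nat (p ^ (e - 1)) - of_int eps * s * G / of_nat p)
        = (p - 1)^2 * p ^ e div 2 \<and>
      freq C (of_nat q - of_nat (p ^ (e - 1)) + of_int eps * s * G / of_nat p)
        = (p - 1)^2 * p ^ e div 2 \<and>
      freq C (of_nat q - of_nat (p ^ (e - 1))) = 2 * p ^ (e + 1) - p ^ e - p \<and>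
      freq C (of_nat q) = p - 1) \<and>
     (e \<ge> 3 \<longrightarrow> self_orthogonal C) \<and>
     (e = 2 \<and> of_int eps * eta0 (-1 :: 'a) = -1 \<longrightarrow>
      has_params (dual_code C) q (q - 4) 4 \<and> almost_MDS (dual_code C) \<and> sp_optimal p q (q - 4) 4) \<and>
     (\<not> (e = 2 \<and> of_int eps * eta0 (-1 :: 'a) = -1) \<longrightarrow>
      has_params (dual_code C) q (q - e - 2) 3 \<and> sp_almost_optimal p q (q - e - 2) 3)"
proof -
  obtain fs :: "'a \<Rightarrow> 'a" where fs: "\<forall>x. f x \<in> Fp" "eps \<in> {1, -1}" "\<forall>b. fs b \<in> Fp"
      "\<forall>b. walsh p e f b = of_int eps * sqrt_pstar p ^ e * zeta p (fs b)"
    using assms(6) unfolding wrb_with_sign_def by blast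
  interpret bent_function p e "TYPE('a)" f fs eps
    by unfold_locales (use assms(1-4) fs in auto)
  obtain h where f0: "f 0 = 0" and h: "even h" "\<forall>a\<in>Fp - {0}. \<forall>x. f (a * x) = a ^ h * f x"
    using assms(5) unfolding in_RF_def by blast
  \<comment> \<open>Homogeneity at the scalar -1, with an even exponent.\<close>
  have f_even: "f (- x) = f x" for x
    using h(2)[rule_format, of "-1" x] h(1) by simp
  have sign: "of_int eps * eta0 (-1 :: 'a) = -1 \<longleftrightarrow> eps * quad_char (-1 :: 'a) = -1"
  proof -
    have "of_int eps * eta0 (-1 :: 'a) = of_int (eps * quad_char (-1 :: 'a))"
      by (simp add: eta0_eq_quad_char)
    moreover have "(-1 :: complex) = of_int (-1)" by simp
    ultimately show ?thesis by (simp only: of_int_eq_iff)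
  qed
  have dim: "code_dim (dual_code C) = q - e - 2"
    using code_dim_dual[OF linear_code_C card_code] by (simp add: C_def q_def)
  have e2_le: "4 \<le> q" if "e = 2"
    using that p_ge_3 mult_mono[of 3 p 3 p] by (simp add: q_def power2_eq_square)
  have "has_params (dual_code C) q (q - 4) 4 \<and> almost_MDS (dual_code C) \<and> sp_optimal p q (q - 4) 4"
    if "e = 2" "of_int eps * eta0 (-1 :: 'a) = -1"
  proof -
    have "min_dist (dual_code C) = 4"
      using min_dist_dual_4 that sign f0 f_even by (simp add: C_def)
    \<comment> \<open>Distance 5 is excluded in both cases: it is 4 + 1 for optimality here and 3 +
      2 for almost optimality below.\<close>
    moreover have "\<not> sphere_packing_admits p q (q - 4) (4 + 1)"
      using not_sphere_packing_admits[OF p_ge_3 e_ge_2, of "4 + 1"] that by (simp add: q_def)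
    ultimately show ?thesis
      using dim that e2_le linear_code_dual assms(4)
      by (simp add: has_params_def almost_MDS_def sp_optimal_def q_def)
  qed
  moreover have "has_params (dual_code C) q (q - e - 2) 3 \<and> sp_almost_optimal p q (q - e - 2) 3"
    if "\<not> (e = 2 \<and> of_int eps * eta0 (-1 :: 'a) = -1)"
  proof -
    have "min_dist (dual_code C) = 3"
      using min_dist_dual_3 that sign f0 f_even by (simp add: C_def)
    moreover have "\<not> sphere_packing_admits p q (q - e - 2) (3 + 2)"
      using not_sphere_packing_admits[OF p_ge_3 e_ge_2, of "3 + 2"] by (simp add: q_def)
    ultimately show ?thesis
      using dim linear_code_dual assms(4)
      by (simp add: has_params_def sp_almost_optimal_def q_def)
  qed
  moreover have "code_dim C = e + 2"
    using code_dim_eq[OF linear_code_C card_code] by (simp add: C_def)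
  ultimately show ?thesis
    using linear_code_C freq_0 freq_full weight_distribution_even weight_distribution_odd self_orthogonal_C
    unfolding C_def q_def s_def G_def by blast
qed

end
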